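(* Let $p \in (1,2]$ and let $p'$ be defined by $1/p+1/p'=1$. Let $X$ be a $(p,C_{\mathrm{sm}})$-smooth Banach space with norm $|\cdot|$, let $(\Omega,(\mathcal{F}_n)_{n\in\mathbb{N}})$ be a filtered probability space, let $(f_n)_{n\in\mathbb{N}}$ be an $X$-valued martingale on it, and let $w:\Omega\to\mathbb{R}_{\ge 0}$ be a measurable function (a weight). Then $$\mathbb{E}(f^{*} w) \le 84\, p'\, C_{\mathrm{sm}}\, \mathbb{E}(S_p f\cdot w^{*}),$$ where $$S_p f = \Bigl(|f_0|^p+\sum_{n=1}^{\infty}|f_n-f_{n-1}|^p\Bigr)^{1/p},\qquad f^{*}=\sup_{n\in\mathbb{N}}|f_n|,\qquad w^{*}=\sup_{n\in\mathbb{N}}\mathbb{E}(w\mid\mathcal{F}_n).$$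
   Context: For $p\in[1,2]$ and $C_{\mathrm{sm}}\in\mathbb{R}_{>0}$, a Banach space $(X,|\cdot|)$ is called $(p,C_{\mathrm{sm}})$-smooth if for all $x,y\in X$, $$\tfrac12\bigl(|x+y|^p+|x-y|^p\bigr)\le |x|^p+C_{\mathrm{sm}}^p|y|^p.$$ Here $\mathbb{N}=\{0,1,2,\dots\}$. Both sides of the inequality take values in $[0,\infty]$. *)

theory Defs
  imports "HOL-Probability.Probability"
begin

definition smooth_space :: "'b::banach itself \<Rightarrow> real \<Rightarrow> real \<Rightarrow> bool" where
  "smooth_space T p C \<longleftrightarrow>
     (\<forall>x y :: 'b. (norm (x + y) powr p + norm (x - y) powr p) / 2
                    \<le> norm x powr p + C powr p * norm y powr p)"

(* The library relation has_bochner_integral, with the separability restriction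
   (class second_countable_topology) on the target removed, so that arbitrary Banach
   spaces are covered.  The approximation by simple functions forces the function
   to be essentially separably valued, i.e. strongly measurable up to null sets. *)
definition has_bint :: "'o measure \<Rightarrow> ('o \<Rightarrow> 'b::banach) \<Rightarrow> 'b \<Rightarrow> bool" where
  "has_bint M f x \<longleftrightarrow> f \<in> borel_measurable M \<and>
     (\<exists>s. (\<forall>i. Bochner_Integration.simple_bochner_integrable M (s i)) \<and>
          (\<lambda>i. \<integral>\<^sup>+\<omega>. ennreal (norm (f \<omega> - s i \<omega>)) \<partial>M) \<longlonglongrightarrow> 0 \<and>
          (\<lambda>i. Bochner_Integration.simple_bochner_integral M (s i)) \<longlonglongrightarrow> x)"

lemma has_bint_iff_has_bochner_integral:
  fixes f :: "'o \<Rightarrow> 'b::{banach, second_countable_topology}"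
  shows "has_bint M f x \<longleftrightarrow> has_bochner_integral M f x"
  unfolding has_bint_def has_bochner_integral.simps by blast

definition bintegrable :: "'o measure \<Rightarrow> ('o \<Rightarrow> 'b::banach) \<Rightarrow> bool" where
  "bintegrable M f \<longleftrightarrow> (\<exists>x. has_bint M f x)"

(* g is a version of the conditional expectation of f given G; the common value x is
   the integral of f, and of g, over A. *)
definition is_cond_exp ::
  "'o measure \<Rightarrow> 'o measure \<Rightarrow> ('o \<Rightarrow> 'b::banach) \<Rightarrow> ('o \<Rightarrow> 'b) \<Rightarrow> bool" where
  "is_cond_exp M G f g \<longleftrightarrow>
     bintegrable M f \<and> bintegrable M g \<and> g \<in> borel_measurable G \<and>
     (\<forall>A\<in>sets G. \<exists>x. has_bint M (\<lambda>\<omega>. indicator A \<omega> *\<^sub>R f \<omega>) x \<and>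
                     has_bint M (\<lambda>\<omega>. indicator A \<omega> *\<^sub>R g \<omega>) x)"

definition martingale ::
  "'o measure \<Rightarrow> (nat \<Rightarrow> 'o measure) \<Rightarrow> (nat \<Rightarrow> 'o \<Rightarrow> 'b::banach) \<Rightarrow> bool" where
  "martingale M F f \<longleftrightarrow>
     (\<forall>n. f n \<in> borel_measurable (F n) \<and> bintegrable M (f n)) \<and>
     (\<forall>m n. m \<le> n \<longrightarrow> is_cond_exp M (F m) (f n) (f m))"

(* intended for exponents a > 0 *)
definition ennpowr :: "ennreal \<Rightarrow> real \<Rightarrow> ennreal" where
  "ennpowr x a = (if x = \<infinity> then \<infinity> else ennreal (enn2real x powr a))"

definition square_fun :: "real \<Rightarrow> (nat \<Rightarrow> 'o \<Rightarrow> 'b::banach) \<Rightarrow> 'o \<Rightarrow> ennreal" where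
  "square_fun p f \<omega> =
     ennpowr (ennreal (norm (f 0 \<omega>) powr p) +
              (\<Sum>n. ennreal (norm (f (Suc n) \<omega> - f n \<omega>) powr p))) (1 / p)"

definition maximal_fun :: "(nat \<Rightarrow> 'o \<Rightarrow> 'b::banach) \<Rightarrow> 'o \<Rightarrow> ennreal" where
  "maximal_fun f \<omega> = (SUP n. ennreal (norm (f n \<omega>)))"

(* The weight need not be integrable, hence nn_cond_exp rather than real_cond_exp. *)
definition maximal_weight ::
  "'o measure \<Rightarrow> (nat \<Rightarrow> 'o measure) \<Rightarrow> ('o \<Rightarrow> real) \<Rightarrow> 'o \<Rightarrow> ennreal" where
  "maximal_weight M F w \<omega> = (SUP n. nn_cond_exp M (F n) (\<lambda>\<omega>. ennreal (w \<omega>)) \<omega>)"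

end

theory Submission
  imports Defs
begin

text \<open>
Write \<open>d\<^sub>n\<close> for the increments of the martingale, \<open>S\<close> for its partial square functions, \<open>m\<close> for its
running maximum, \<open>w\<^sub>n\<close> for the conditional expectations of the weight and \<open>W\<close> for their running
maximum.  The proof bounds \<open>m\<close> path by path by a multiple of \<open>S\<close> plus a stochastic integral, and then
the weighted expectation of that stochastic integral by the scalar interplay of \<open>|d\<^sub>n|\<close> and \<open>w\<^sub>n\<close>.

Smoothness supplies a substitute for the derivative of the norm.  Applying the tangent line of
\<open>t\<^sup>p\<close> to the reflected point \<open>x - y\<close> turns the defining inequality into
\<open>|x+y|\<^sup>p \<le> |x|\<^sup>p + p |x|\<^sup>p\<^sup>-\<^sup>1 h + 2 C\<^sup>p |y|\<^sup>p\<close> with \<open>h = |x| - |x-y|\<close> (\<open>smooth_space_step\<close>).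
If \<open>x = f\<^sub>n\<close> and \<open>y = d\<^sub>n\<^sub>+\<^sub>1\<close>, then \<open>|h| \<le> |y|\<close>, and \<open>h\<close> has nonpositive conditional expectation
because \<open>f\<^sub>n\<close> is the conditional mean of \<open>f\<^sub>n - d\<^sub>n\<^sub>+\<^sub>1\<close> (\<open>conditional_jensen_reflected\<close>).

With \<open>B = max m (C S)\<close>, the potential \<open>|f|\<^sup>p / B\<^sup>p\<^sup>-\<^sup>1 + (p-1) B\<close> dominates \<open>(p-1) m\<close>, and in each step
it grows by at most a predictable coefficient in \<open>[0,p]\<close> times \<open>h\<close> plus \<open>12 p C\<close> times the increment
of \<open>S\<close> (\<open>maximal_potential_step\<close>).  The factor \<open>p - 1\<close> in front of \<open>m\<close> produces \<open>p'\<close>.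

After multiplication by the weight, \<open>h w\<^sub>n\<^sub>+\<^sub>1 = h w\<^sub>n + h (w\<^sub>n\<^sub>+\<^sub>1 - w\<^sub>n)\<close>; the first term has nonpositive
expectation and the second is at most \<open>|d\<^sub>n\<^sub>+\<^sub>1| |w\<^sub>n\<^sub>+\<^sub>1 - w\<^sub>n|\<close>.  Young's inequality splits this product
into \<open>W |d|\<^sup>2 / S\<close>, which is controlled by increments of \<open>S\<close>, and \<open>S |w\<^sub>n\<^sub>+\<^sub>1 - w\<^sub>n|\<^sup>2 / W\<close>, which is
controlled by the increments of \<open>S (2 W + w\<^sub>n\<^sup>2 / W)\<close> up to a martingale difference
(\<open>weight_potential_step\<close>).  Summation gives \<open>5/2\<close> times the expectation of \<open>S W\<close>
(\<open>weight_square_function_bound\<close>).  The total constant \<open>(12 p C + 5 p / 2) / (p - 1)\<close> is below \<open>84 p' C\<close>.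

A Borel function with values in a Banach space need not be separably valued, and differences of Borel
functions need not be Borel.  Each \<open>f\<^sub>n\<close> therefore gets replaced by an almost surely equal, adapted and
separably valued version before any sums are formed (\<open>separable_version\<close>).
\<close>

section \<open>Powers, running maxima and partial square functions\<close>

text \<open>
The graph of \<open>t\<^sup>p\<close> lies above its tangent at \<open>u\<close>; this is \<open>p\<close> times Young's
inequality for \<open>u\<^sup>p\<^sup>-\<^sup>1 v\<close>.
\<close>

lemma powr_tangent_le:
  fixes u v p :: real
  assumes "1 \<le> p" "0 \<le> u" "0 \<le> v"
  shows "u powr p - v powr p \<le> p * u powr (p - 1) * (u - v)"
proof (cases "u = 0 \<or> v = 0")
  case True
  have "u powr p = u * u powr (p - 1)"
    using assms by (simp add: powr_mult_base)
  moreover have "0 \<le> (p - 1) * u powr p" using assms by simp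
  ultimately show ?thesis using True by (auto simp: algebra_simps)
next
  case False
  have "(u powr p) powr ((p - 1) / p) * (v powr p) powr (1 / p)
      \<le> (p - 1) / p * u powr p + 1 / p * v powr p"
    using assms False by (intro Youngs_inequality_0) (auto simp: field_simps)
  then have "u powr (p - 1) * v \<le> (p - 1) / p * u powr p + 1 / p * v powr p"
    using assms by (simp add: powr_powr)
  then have "p * (u powr (p - 1) * v) \<le> p * ((p - 1) / p * u powr p + 1 / p * v powr p)"
    using assms by (intro mult_left_mono) auto
  also have "\<dots> = (p - 1) * u powr p + v powr p"
    using assms by (simp add: field_simps)
  also have "u powr p = u * u powr (p - 1)"
    using assms by (simp add: powr_mult_base)
  finally show ?thesis
    using assms by (simp add: algebra_simps powr_mult_base)
qed

text \<open>
The hypotheses make \<open>S'\<close> the \<open>\<ell>\<^sup>p\<close> norm of \<open>(S, d)\<close>, which lies between the maximum and the sum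
of its entries.
\<close>

lemma powr_sum_root_bounds:
  fixes S S' d p :: real
  assumes p: "1 \<le> p" and S: "0 \<le> S" "0 \<le> S'" "S' powr p = S powr p + d powr p" and d: "0 \<le> d"
  shows "S \<le> S'" "d \<le> S'" "S' \<le> S + d"
proof -
  have mono: "x \<le> y" if "0 \<le> x" "0 \<le> y" "x powr p \<le> y powr p" for x y :: real
    using that p powr_less_mono2[of p y x] by (cases "y < x") auto
  show "S \<le> S'" by (rule mono) (use S in auto)
  show "d \<le> S'" by (rule mono) (use S d in auto)
  show "S' \<le> S + d"
  proof (rule mono)
    have "S powr p + d powr p = S * S powr (p - 1) + d * d powr (p - 1)"
      using S d by (simp add: powr_mult_base)
    also have "\<dots> \<le> S * (S + d) powr (p - 1) + d * (S + d) powr (p - 1)"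
      using S d p by (intro add_mono mult_left_mono powr_mono2) auto
    also have "\<dots> = (S + d) powr p"
      using S d by (simp add: powr_mult_base flip: distrib_right)
    finally show "S' powr p \<le> (S + d) powr p" using S by simp
  qed (use S d in auto)
qed

primrec run_max :: "(nat \<Rightarrow> real) \<Rightarrow> nat \<Rightarrow> real" where
  "run_max u 0 = u 0"
| "run_max u (Suc n) = max (run_max u n) (u (Suc n))"

lemma run_max_ge: "k \<le> n \<Longrightarrow> u k \<le> run_max u n"
  by (induction n) (auto simp: le_Suc_eq)

lemma run_max_le: "(\<And>k. k \<le> n \<Longrightarrow> u k \<le> c) \<Longrightarrow> run_max u n \<le> c"
  by (induction n) auto

lemma run_max_mono: "i \<le> j \<Longrightarrow> run_max u i \<le> run_max u j"
  by (induction j) (auto simp: le_Suc_eq)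

definition partial_square :: "real \<Rightarrow> (nat \<Rightarrow> real) \<Rightarrow> nat \<Rightarrow> real" where
  "partial_square p d n = (\<Sum>j\<le>n. d j powr p) powr (1 / p)"

lemma partial_square_nonneg: "0 \<le> partial_square p d n"
  by (simp add: partial_square_def)

lemma partial_square_powr:
  assumes "0 < p"
  shows "partial_square p d n powr p = (\<Sum>j\<le>n. d j powr p)"
  using assms by (simp add: partial_square_def powr_powr sum_nonneg)

lemma partial_square_Suc:
  assumes "0 < p"
  shows "partial_square p d (Suc n) powr p = partial_square p d n powr p + d (Suc n) powr p"
  using assms by (simp add: partial_square_powr)

section \<open>Smoothness and the maximal function along one path\<close>

text \<open>
A one-sided Taylor expansion of \<open>|x|\<^sup>p\<close>.  Bounding \<open>|x-y|\<^sup>p\<close> from below by the tangent line at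
\<open>|x|\<close> replaces the linear term by \<open>|x| - |x-y|\<close>, whose conditional expectation Jensen's inequality controls.
\<close>

lemma smooth_space_step:
  fixes x y :: "'b::banach"
  assumes "smooth_space TYPE('b) p C" "1 \<le> p"
  shows "norm (x + y) powr p \<le> norm x powr p
    + p * norm x powr (p - 1) * (norm x - norm (x - y)) + 2 * C powr p * norm y powr p"
proof -
  have "(norm (x + y) powr p + norm (x - y) powr p) / 2 \<le> norm x powr p + C powr p * norm y powr p"
    using assms(1) by (simp add: smooth_space_def)
  moreover have "norm x powr p - norm (x - y) powr p \<le> p * norm x powr (p - 1) * (norm x - norm (x - y))"
    using assms(2) by (intro powr_tangent_le) auto
  ultimately show ?thesis by argo
qed

text \<open>
At \<open>x = 0\<close> the smoothness inequality compares \<open>|y|\<^sup>p\<close> with \<open>C\<^sup>p |y|\<^sup>p\<close>.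
\<close>

lemma smooth_const_ge_1:
  fixes y :: "'b::banach"
  assumes "smooth_space TYPE('b) p C" "0 < p" "0 < C" "y \<noteq> 0"
  shows "1 \<le> C"
proof -
  have "(norm (0 + y) powr p + norm (0 - y) powr p) / 2 \<le> norm (0::'b) powr p + C powr p * norm y powr p"
    using assms(1) unfolding smooth_space_def by blast
  then have "1 * norm y powr p \<le> C powr p * norm y powr p" by simp
  then have "1 \<le> C powr p" using assms(4) by (subst (asm) mult_le_cancel_right) auto
  then show ?thesis
    using assms(2,3) powr_mono2[of p C 1] powr_less_one[of C p] by (cases "C < 1") auto
qed

text \<open>
One step of the potential \<open>a\<^sup>p / B\<^sup>p\<^sup>-\<^sup>1 + (p-1) B\<close>, where \<open>a\<close> is the norm of the current value, \<open>m\<close>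
its running maximum, \<open>S\<close> the partial square function and \<open>d\<close> the size of the jump.

The potential is the value at \<open>B\<close> of a function that, for fixed \<open>a\<close>, has its minimum over \<open>B\<close> at
\<open>B = a\<close>.  Hence a new maximum \<open>B' = a'\<close> does not increase it, and if \<open>B\<close> grows because of \<open>S\<close> the cost
is at most \<open>(p-1) C (S' - S)\<close>.  The choice of \<open>C S\<close> in \<open>B\<close> turns the smoothness error \<open>C\<^sup>p d\<^sup>p / B\<^sup>p\<^sup>-\<^sup>1\<close>
into \<open>C d\<^sup>p / S\<^sup>p\<^sup>-\<^sup>1\<close>, which is of the order \<open>C (S' - S)\<close> as long as \<open>d \<le> S\<close>.  For larger jumps \<open>d\<close>
itself is at most \<open>4 (S' - S)\<close>, and crude Lipschitz bounds suffice.
\<close>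

lemma maximal_potential_step:
  fixes p C :: real
  assumes p: "1 < p" "p \<le> 2" and C: "1 \<le> C"
    and a: "0 \<le> a" "a \<le> m" "0 \<le> a'" "a' \<le> a + d"
    and S: "0 \<le> S" "0 \<le> S'" "S' powr p = S powr p + d powr p"
    and h: "\<bar>h\<bar> \<le> d"
    and step: "a' powr p \<le> a powr p + p * a powr (p - 1) * h + 2 * C powr p * d powr p"
    and B: "B = max m (C * S)" and B': "B' = max (max m a') (C * S')"
  shows "a' powr p / B' powr (p - 1) + (p - 1) * B'
    \<le> a powr p / B powr (p - 1) + (p - 1) * B
      + p * (a powr (p - 1) / B powr (p - 1)) * h + 12 * p * C * (S' - S)"
proof -
  have d: "0 \<le> d" using h by linarith
  have SS': "S \<le> S'" and dS': "d \<le> S'"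
    using powr_sum_root_bounds[OF _ S d] p by auto
  have "C * S \<le> C * S'" using SS' C by (intro mult_left_mono) auto
  then have aB: "a \<le> B" "0 \<le> B" and aB': "a' \<le> B'" and BB': "B \<le> B'" "0 \<le> B'"
    using a B B' by auto
  have B1: "C * S \<le> B" using B by simp
  have Hle: "a powr (p - 1) / B powr (p - 1) \<le> 1"
    using aB a p by (auto simp: divide_le_eq_1 powr_mono2)
  have Hh: "- (p * (a powr (p - 1) / B powr (p - 1)) * h) \<le> p * d"
  proof -
    have "- (p * (a powr (p - 1) / B powr (p - 1)) * h) \<le> \<bar>p * (a powr (p - 1) / B powr (p - 1)) * h\<bar>"
      by (rule abs_ge_minus_self)
    also have "\<dots> = p * (a powr (p - 1) / B powr (p - 1)) * \<bar>h\<bar>" using p by (simp add: abs_mult)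
    also have "\<dots> \<le> p * 1 * d" using p Hle h by (intro mult_mono) auto
    finally show ?thesis by simp
  qed
  have CSS: "0 \<le> C * (S' - S)" using C SS' by simp
  have key: "B' \<le> B + C * (S' - S) + d"
    using a B B' CSS d by (simp add: algebra_simps max_def split: if_splits)
  show ?thesis
  proof (cases "d \<le> 4 * (S' - S)")
    case True
    \<comment> \<open>A large jump: everything is bounded by multiples of \<open>d\<close>, including the term with \<open>h\<close>.\<close>
    have le1: "a powr p / B' powr (p - 1) \<le> a powr p / B powr (p - 1)"
    proof (cases "B = 0")
      case True then show ?thesis using aB a p by simp
    next
      case False then show ?thesis using aB BB' p by (intro divide_left_mono powr_mono2) auto
    qed
    have "a' powr p - a powr p \<le> p * a' powr (p - 1) * (a' - a)"
      using a p by (intro powr_tangent_le) auto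
    also have "\<dots> \<le> p * a' powr (p - 1) * d"
      using a p by (intro mult_left_mono) auto
    also have "\<dots> \<le> p * B' powr (p - 1) * d"
      using a p d aB' by (intro mult_left_mono mult_right_mono powr_mono2) auto
    finally have "(a' powr p - a powr p) / B' powr (p - 1) \<le> p * d"
      using p d BB' by (cases "B' = 0") (auto simp: divide_le_eq mult.assoc mult.commute mult.left_commute)
    then have 1: "a' powr p / B' powr (p - 1) - a powr p / B powr (p - 1) \<le> p * d"
      using le1 by (simp add: diff_divide_distrib)
    have "S' - S \<le> C * (S' - S)" using C SS' mult_right_mono[of 1 C "S' - S"] by simp
    then have "4 * (S' - S) \<le> 4 * (C * (S' - S))" by (intro mult_left_mono) auto
    with True have d4: "d \<le> 4 * (C * (S' - S))" by (rule order_trans)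
    have "p * d \<le> p * (4 * (C * (S' - S)))" using d4 p by (intro mult_left_mono) auto
    moreover have "(p - 1) * (B' - B) \<le> (p - 1) * (4 * (C * (S' - S)))"
    proof -
      have "B' - B \<le> 4 * (C * (S' - S))"
        using a B B' CSS d4 by (simp add: algebra_simps max_def split: if_splits)
      then show ?thesis using p by (intro mult_left_mono) auto
    qed
    moreover have "(p - 1) * (4 * (C * (S' - S))) \<le> p * (4 * (C * (S' - S)))"
      using p CSS by (intro mult_right_mono) auto
    moreover have "12 * p * C * (S' - S) = 3 * (p * (4 * (C * (S' - S))))" by simp
    moreover have "(p - 1) * (B' - B) = (p - 1) * B' - (p - 1) * B" by (rule right_diff_distrib)
    ultimately show ?thesis using 1 Hh by linarith
  next
    case False
    \<comment> \<open>If the jump were larger than \<open>S\<close>, then \<open>S'\<^sup>p \<ge> 2 S\<^sup>p \<ge> (4/3 \<cdot> S)\<^sup>p\<close>, so \<open>d \<le> S' \<le> 4 (S' - S)\<close>,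
      which was excluded; the number \<open>4/3\<close> works because \<open>(4/3)\<^sup>2 \<le> 2\<close> and \<open>p \<le> 2\<close>.\<close>
    have dS: "d \<le> S"
    proof (rule ccontr)
      assume "\<not> d \<le> S"
      then have "S < d" by simp
      then have "S powr p \<le> d powr p" using S p by (intro powr_mono2) auto
      have "S = 0 \<or> S \<le> 3/4 * S'"
      proof (cases "S = 0")
        case False
        have "(4/3::real) powr p \<le> (4/3) powr 2" using p by (intro powr_mono) auto
        also have "\<dots> \<le> 2" by (simp add: powr_numeral power2_eq_square)
        finally have "(4/3) powr p * S powr p \<le> 2 * S powr p"
          by (intro mult_right_mono) auto
        then have "(4/3 * S) powr p \<le> 2 * S powr p"
          using powr_mult[of "4/3" S p] S by simp
        also have "\<dots> \<le> S' powr p" using \<open>S powr p \<le> d powr p\<close> S by simp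
        finally have "4/3 * S \<le> S'"
          using S p by (smt (verit) powr_less_mono2)
        then show ?thesis by simp
      qed simp
      then show False using False \<open>S < d\<close> SS' dS' by auto
    qed
    have Spos: "0 < S"
    proof (rule ccontr)
      assume "\<not> 0 < S"
      then have "S = 0" "d = 0" using S dS d by auto
      then show False using False SS' by simp
    qed
    then have Bpos: "0 < B" using B1 C by (smt (verit) mult_pos_pos)
    have b: "C powr (p - 1) * S powr (p - 1) \<le> B powr (p - 1)"
      using B1 C S p by (subst powr_mult[symmetric]) (auto intro!: powr_mono2)
    have S2: "S' \<le> 2 * S"
    proof (rule ccontr)
      assume "\<not> S' \<le> 2 * S"
      then have "(2 * S) powr p < S' powr p" using S p by (intro powr_less_mono2) auto
      moreover have "d powr p \<le> S powr p" using dS d p by (intro powr_mono2) auto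
      moreover have "2 * S powr p \<le> (2 * S) powr p"
      proof -
        have "(2::real) powr 1 \<le> 2 powr p" using p by (intro powr_mono) auto
        then show ?thesis using S by (simp add: powr_mult mult_right_mono)
      qed
      ultimately show False using S by simp
    qed
    have "d powr p = S' powr p - S powr p" using S by simp
    also have "\<dots> \<le> p * S' powr (p - 1) * (S' - S)" using S p by (intro powr_tangent_le) auto
    also have "\<dots> \<le> p * (2 * S powr (p - 1)) * (S' - S)"
    proof -
      have "S' powr (p - 1) \<le> (2 * S) powr (p - 1)" using S S2 p by (intro powr_mono2) auto
      also have "\<dots> = 2 powr (p - 1) * S powr (p - 1)" using S by (simp add: powr_mult)
      also have "\<dots> \<le> 2 powr 1 * S powr (p - 1)" using p by (intro mult_right_mono powr_mono) auto
      finally show ?thesis using p SS' by (intro mult_left_mono mult_right_mono) auto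
    qed
    finally have dp: "d powr p \<le> 2 * p * (S' - S) * S powr (p - 1)"
      by (simp only: mult.assoc mult.commute mult.left_commute)
    have "C powr p = C * C powr (p - 1)" using C by (simp add: powr_mult_base)
    then have "2 * C powr p * d powr p \<le> 2 * (C * C powr (p - 1)) * (2 * p * (S' - S) * S powr (p - 1))"
      using C dp by (auto intro!: mult_left_mono)
    also have "\<dots> = 4 * p * C * (S' - S) * (C powr (p - 1) * S powr (p - 1))" by simp
    also have "\<dots> \<le> 4 * p * C * (S' - S) * B powr (p - 1)"
      using b p C SS' by (intro mult_left_mono) auto
    finally have "a' powr p \<le> a powr p + p * a powr (p - 1) * h + 4 * p * C * (S' - S) * B powr (p - 1)"
      using step by linarith
    then have "a' powr p / B powr (p - 1)
        \<le> (a powr p + p * a powr (p - 1) * h + 4 * p * C * (S' - S) * B powr (p - 1)) / B powr (p - 1)"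
      by (intro divide_right_mono) auto
    also have "\<dots> = a powr p / B powr (p - 1) + p * (a powr (p - 1) / B powr (p - 1)) * h + 4 * p * C * (S' - S)"
      using Bpos by (simp add: add_divide_distrib)
    finally have 1: "a' powr p / B powr (p - 1) \<le> \<dots>" .
    \<comment> \<open>Passing from \<open>B\<close> to \<open>B'\<close> with \<open>a'\<close> fixed: either \<open>B'\<close> grew only through \<open>S\<close>, or \<open>B' = a'\<close>
      is the minimum point of the potential.\<close>
    have 2: "a' powr p / B' powr (p - 1) + (p - 1) * B' \<le> a' powr p / B powr (p - 1) + (p - 1) * B + (p - 1) * (C * (S' - S))"
    proof (cases "B' \<le> B + C * (S' - S)")
      case True
      have "a' powr p / B' powr (p - 1) \<le> a' powr p / B powr (p - 1)"
        using Bpos BB' p by (intro divide_left_mono powr_mono2) auto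
      moreover have "(p - 1) * B' \<le> (p - 1) * (B + C * (S' - S))" using True p by (intro mult_left_mono) auto
      ultimately show ?thesis by (simp add: distrib_left)
    next
      case False
      then have *: "B' = a'" "B \<le> a'" using B B' CSS by (auto simp: max_def algebra_simps split: if_splits)
      have a'pos: "0 < a'" using * Bpos by simp
      have "p * B powr (p - 1) * a' \<le> a' powr p + (p - 1) * B powr p"
        using powr_tangent_le[of p B a'] Bpos p a by (simp add: algebra_simps powr_mult_base)
      then have "p * B powr (p - 1) * a' / B powr (p - 1) \<le> (a' powr p + (p - 1) * (B * B powr (p - 1))) / B powr (p - 1)"
        using Bpos by (intro divide_right_mono) (auto simp: powr_mult_base)
      then have "p * a' \<le> a' powr p / B powr (p - 1) + (p - 1) * B"
        using Bpos by (simp add: add_divide_distrib)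
      moreover have "a' powr p = a' * a' powr (p - 1)" using a'pos by (simp add: powr_mult_base)
      then have "a' powr p / B' powr (p - 1) + (p - 1) * B' = p * a'"
        using * a'pos by (simp add: algebra_simps)
      moreover have "0 \<le> (p - 1) * (C * (S' - S))" using p CSS by simp
      ultimately show ?thesis by linarith
    qed
    have "(p - 1) * (C * (S' - S)) \<le> p * (C * (S' - S))" using CSS by (intro mult_right_mono) auto
    moreover have "0 \<le> p * (C * (S' - S))" using p CSS by simp
    ultimately show ?thesis using 1 2 by (simp add: mult.assoc)
  qed
qed

text \<open>
The telescoped form of \<open>maximal_potential_step\<close>.  The term \<open>a n - b n\<close> stands for \<open>h = |x| - |x-y|\<close>, and
its coefficient only depends on the past.
\<close>

lemma pathwise_maximal_bound:
  fixes a b d :: "nat \<Rightarrow> real"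
  assumes p: "1 < p" "p \<le> 2" and C: "1 \<le> C"
    and nonneg: "\<And>n. 0 \<le> a n" "\<And>n. 0 \<le> d n"
    and a0: "a 0 = d 0" and a_Suc: "\<And>n. a (Suc n) \<le> a n + d (Suc n)"
    and b: "\<And>n. \<bar>a n - b n\<bar> \<le> d (Suc n)"
    and step: "\<And>n. a (Suc n) powr p \<le> a n powr p + p * a n powr (p - 1) * (a n - b n) + 2 * C powr p * d (Suc n) powr p"
  defines "B \<equiv> \<lambda>n. max (run_max a n) (C * partial_square p d n)"
  shows "(p - 1) * run_max a N \<le> 12 * p * C * partial_square p d N
    + (\<Sum>k<N. p * (a k powr (p - 1) / B k powr (p - 1)) * (a k - b k))"
proof -
  have "a N powr p / B N powr (p - 1) + (p - 1) * B N \<le> 12 * p * C * partial_square p d N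
    + (\<Sum>k<N. p * (a k powr (p - 1) / B k powr (p - 1)) * (a k - b k))"
  proof (induction N)
    \<comment> \<open>The starting value is treated as a jump from the zero state, in which all quotients are zero.\<close>
    case 0
    have "d 0 powr p \<le> 2 * C powr p * d 0 powr p"
    proof -
      have "1 \<le> C powr p" using C p by (simp add: ge_one_powr_ge_zero)
      then show ?thesis using mult_right_mono[of 1 "2 * C powr p" "d 0 powr p"] by simp
    qed
    moreover have "partial_square p d 0 powr p = 0 powr p + d 0 powr p"
      using p by (simp add: partial_square_powr)
    ultimately have "a 0 powr p / B 0 powr (p - 1) + (p - 1) * B 0
        \<le> 0 powr p / 0 powr (p - 1) + (p - 1) * 0 + p * (0 powr (p - 1) / 0 powr (p - 1)) * 0
          + 12 * p * C * (partial_square p d 0 - 0)"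
    proof (intro maximal_potential_step[where d = "d 0" and m = 0] p C)
      have "0 \<le> C * partial_square p d 0" using C partial_square_nonneg[of p d 0] by simp
      then show "B 0 = max (max 0 (a 0)) (C * partial_square p d 0)"
        using nonneg(1)[of 0] by (simp add: B_def)
    qed (use nonneg a0 p partial_square_nonneg[of p d 0] in simp_all)
    then show ?case by simp
  next
    case (Suc N)
    have "a (Suc N) powr p / B (Suc N) powr (p - 1) + (p - 1) * B (Suc N)
        \<le> a N powr p / B N powr (p - 1) + (p - 1) * B N
          + p * (a N powr (p - 1) / B N powr (p - 1)) * (a N - b N)
          + 12 * p * C * (partial_square p d (Suc N) - partial_square p d N)"
    proof (rule maximal_potential_step[OF p C nonneg(1) run_max_ge[OF order_refl] nonneg(1) a_Suc
          partial_square_nonneg partial_square_nonneg _ b step])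
      show "partial_square p d (Suc N) powr p = partial_square p d N powr p + d (Suc N) powr p"
        using p by (simp add: partial_square_Suc)
    qed (simp_all add: B_def)
    also have "12 * p * C * (partial_square p d (Suc N) - partial_square p d N)
      = 12 * p * C * partial_square p d (Suc N) - 12 * p * C * partial_square p d N"
      by (rule right_diff_distrib)
    finally show ?case using Suc.IH by simp
  qed
  moreover have "(p - 1) * run_max a N \<le> (p - 1) * B N"
    using p by (intro mult_left_mono) (auto simp: B_def)
  moreover have "0 \<le> a N powr p / B N powr (p - 1)" by simp
  ultimately show ?thesis by linarith
qed

section \<open>The weight along one path\<close>

text \<open>
Here \<open>v\<close>, \<open>v'\<close> are consecutive values of the weight martingale and \<open>W\<close>, \<open>W'\<close> its running maxima.
While the maximum stays constant, \<open>(v' - v)\<^sup>2 / W\<close> is the increment of \<open>v\<^sup>2 / W\<close> up to a term linear in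
\<open>v' - v\<close>; the summand \<open>2 W\<close> pays for the steps in which the maximum grows.  The coefficient of the
linear term contains the old value \<open>S\<close> and not \<open>S'\<close>, since it has to be predictable.
\<close>

lemma weight_potential_step:
  fixes v v' W W' S S' :: real
  assumes v: "0 \<le> v" "v \<le> W" "0 \<le> v'" "W' = max W v'" and S: "0 \<le> S" "S \<le> S'"
  shows "S' * (v' - v)\<^sup>2 / W' \<le> S' * (2 * W' + v'\<^sup>2 / W') - S * (2 * W + v\<^sup>2 / W) - 2 * (S * (v / W) * (v' - v))"
proof (cases "W' = 0")
  case True
  then have "W = 0" "v = 0" "v' = 0" using v by auto
  then show ?thesis using True by simp
next
  case False
  then have W': "0 < W'" "v \<le> W'" "W \<le> W'" "v' \<le> W'" using v by auto
  have 1: "(v' - v)\<^sup>2 / W' \<le> 2 * W' + v'\<^sup>2 / W'"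
  proof -
    have "(v' - v)\<^sup>2 \<le> W' * W'" 
      using abs_le_square_iff[of "v' - v" W'] v W' by (auto simp: power2_eq_square)
    also have "\<dots> \<le> (2 * W' + v'\<^sup>2 / W') * W'" using W' by (intro mult_right_mono) auto
    finally show ?thesis using W' by (simp add: divide_le_eq)
  qed
  have 2: "(v' - v)\<^sup>2 / W' \<le> (2 * W' + v'\<^sup>2 / W') - (2 * W + v\<^sup>2 / W) - 2 * (v / W) * (v' - v)"
  proof (cases "W = 0")
    case True
    then have "v = 0" "W' = v'" using v by auto
    with True show ?thesis using W' by simp
  next
    case False
    then have W: "0 < W" using v by auto
    show ?thesis
    proof (cases "v' \<le> W")
      case True
      then have "W' = W" using v by simp
      then show ?thesis using W by (simp add: field_simps power2_eq_square)
    next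
      case False
      then have W'eq: "W' = v'" using v by simp
      have "0 \<le> (v' - W) * ((2 - 2 * (v / W)) + v\<^sup>2 / (W * v'))"
        using False v W by (intro mult_nonneg_nonneg add_nonneg_nonneg) (auto simp: divide_le_eq)
      also have "\<dots> = (2 * v' + v'\<^sup>2 / v') - (2 * W + v\<^sup>2 / W) - 2 * (v / W) * (v' - v) - (v' - v)\<^sup>2 / v'"
        using W W' W'eq by (simp add: field_simps power2_eq_square)
      finally show ?thesis using W'eq by simp
    qed
  qed
  \<comment> \<open>The old value \<open>S\<close> is combined with the sharp estimate, the increment \<open>S' - S\<close> with the crude one.\<close>
  have "S' * (v' - v)\<^sup>2 / W' = S * ((v' - v)\<^sup>2 / W') + (S' - S) * ((v' - v)\<^sup>2 / W')"
    by (simp add: left_diff_distrib diff_divide_distrib)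
  also have "\<dots> \<le> S * ((2 * W' + v'\<^sup>2 / W') - (2 * W + v\<^sup>2 / W) - 2 * (v / W) * (v' - v)) + (S' - S) * (2 * W' + v'\<^sup>2 / W')"
    using 1 2 S by (intro add_mono mult_left_mono) auto
  also have "\<dots> = S' * (2 * W' + v'\<^sup>2 / W') - S * (2 * W + v\<^sup>2 / W) - 2 * (S * (v / W) * (v' - v))"
    by (simp add: algebra_simps diff_divide_distrib add_divide_distrib)
  finally show ?thesis .
qed

text \<open>
Young's inequality, with the two squares absorbed by the increments of \<open>S W\<close> and, through
\<open>weight_potential_step\<close>, of \<open>S (2 W + v\<^sup>2 / W)\<close>.
\<close>

lemma weighted_increment_step:
  fixes v v' W W' S S' d :: real
  assumes v: "0 \<le> v" "v \<le> W" "0 \<le> v'" "W' = max W v'" and S: "0 \<le> S" "S \<le> S'"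
    and d: "0 \<le> d" "d\<^sup>2 \<le> 2 * S' * (S' - S)"
  shows "d * \<bar>v' - v\<bar> \<le> (S' * W' + S' * (2 * W' + v'\<^sup>2 / W') / 2)
    - (S * W + S * (2 * W + v\<^sup>2 / W) / 2) - S * (v / W) * (v' - v)"
proof -
  have WW: "0 \<le> W'" "W \<le> W'" using v by auto
  have 1: "d * \<bar>v' - v\<bar> \<le> W' * (S' - S) + S' * (v' - v)\<^sup>2 / W' / 2"
  proof (cases "W' = 0 \<or> S' = 0")
    case True
    then have "(v = 0 \<and> v' = 0) \<or> d = 0" using v d S by auto
    then show ?thesis using True S WW by auto
  next
    case False
    then have pos: "0 < W'" "0 < S'" using WW S by auto
    have "(d * \<bar>v' - v\<bar>) * 2 \<le> d\<^sup>2 * (W' / S') + (v' - v)\<^sup>2 * (S' / W')"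
    proof -
      \<comment> \<open>Young's inequality for \<open>d W'\<close> and \<open>|v' - v| S'\<close>, divided by \<open>W' S'\<close>.\<close>
      have "(d * W') * (\<bar>v' - v\<bar> * S') * 2 \<le> (d * W')\<^sup>2 + (\<bar>v' - v\<bar> * S')\<^sup>2"
        using sum_squares_bound[of "d * W'" "\<bar>v' - v\<bar> * S'"] by (simp add: mult_ac)
      then have "(d * W') * (\<bar>v' - v\<bar> * S') * 2 / (W' * S')
          \<le> ((d * W')\<^sup>2 + (\<bar>v' - v\<bar> * S')\<^sup>2) / (W' * S')"
        using pos by (intro divide_right_mono) auto
      also have "\<dots> = d\<^sup>2 * (W' / S') + (v' - v)\<^sup>2 * (S' / W')"
      proof -
        have "\<bar>v' - v\<bar> * (\<bar>v' - v\<bar> * S') = (v' - v) * ((v' - v) * S')"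
          by (metis abs_mult_self_eq mult.assoc)
        then show ?thesis
          using pos by (simp add: add_divide_distrib power_mult_distrib power2_eq_square mult.assoc)
      qed
      finally show ?thesis using pos by (simp add: mult.commute mult.left_commute)
    qed
    also have "d\<^sup>2 * (W' / S') \<le> 2 * S' * (S' - S) * (W' / S')"
      using d pos by (intro mult_right_mono) auto
    also have "\<dots> = 2 * (W' * (S' - S))" using pos by simp
    finally show ?thesis by (simp add: mult.commute)
  qed
  have "S * W \<le> S * W'" using S WW by (intro mult_left_mono)
  then have "W' * (S' - S) \<le> S' * W' - S * W" by (simp add: algebra_simps)
  moreover have half: "x / 2 \<le> y / 2 - z / 2 - u" if "x \<le> y - z - 2 * u" for x y z u :: real
    using that by simp
  ultimately show ?thesis using 1 half[OF weight_potential_step[OF v S]] by linarith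
qed

text \<open>
As \<open>d \<le> S'\<close> and \<open>p \<le> 2\<close>, the quotient \<open>d\<^sup>2 / S'\<close> is at most
\<open>d\<^sup>p / S'\<^sup>p\<^sup>-\<^sup>1\<close>, and the tangent line of \<open>t\<^sup>p\<close> bounds the latter by \<open>p (S' - S)\<close>.
\<close>

lemma powr_increment_square_le:
  fixes S S' d p :: real
  assumes p: "1 < p" "p \<le> 2" and S: "0 \<le> S" "0 \<le> S'" "S' powr p = S powr p + d powr p" and d: "0 \<le> d"
  shows "d\<^sup>2 \<le> 2 * S' * (S' - S)"
proof -
  have dS: "d \<le> S'" and SS': "S \<le> S'"
    using powr_sum_root_bounds[OF _ S d] p by auto
  have "d powr 2 = d powr p * d powr (2 - p)" by (simp flip: powr_add)
  also have "\<dots> \<le> (2 * S' powr (p - 1) * (S' - S)) * S' powr (2 - p)"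
  proof (intro mult_mono)
    have "d powr p \<le> p * S' powr (p - 1) * (S' - S)" using powr_tangent_le[of p S' S] S p by simp
    also have "\<dots> \<le> 2 * S' powr (p - 1) * (S' - S)" using p SS' by (intro mult_right_mono) auto
    finally show "d powr p \<le> 2 * S' powr (p - 1) * (S' - S)" .
    show "d powr (2 - p) \<le> S' powr (2 - p)" using d dS p by (intro powr_mono2) auto
  qed (use SS' in auto)
  also have "\<dots> = 2 * (S' powr (p - 1) * S' powr (2 - p)) * (S' - S)" by simp
  also have "S' powr (p - 1) * S' powr (2 - p) = S'" using S by (simp flip: powr_add)
  finally show "d\<^sup>2 \<le> 2 * S' * (S' - S)" using d by (cases "d = 0") (auto simp: powr_numeral)
qed
lemma pathwise_weight_bound:
  fixes d v :: "nat \<Rightarrow> real"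
  assumes p: "1 < p" "p \<le> 2" and nonneg: "\<And>n. 0 \<le> d n" "\<And>n. 0 \<le> v n"
  defines "S \<equiv> partial_square p d" and "W \<equiv> run_max v"
  shows "(\<Sum>k<N. d (Suc k) * \<bar>v (Suc k) - v k\<bar>)
    \<le> 5 / 2 * (S N * W N) - (\<Sum>k<N. S k * (v k / W k) * (v (Suc k) - v k))"
proof -
  \<comment> \<open>The potential whose increments dominate the summands; it lies between \<open>0\<close> and \<open>5/2 \<cdot> S W\<close>.\<close>
  define Q where "Q = (\<lambda>n. S n * W n + S n * (2 * W n + (v n)\<^sup>2 / W n) / 2)"
  have vW: "v n \<le> W n" for n unfolding W_def by (rule run_max_ge) simp
  have W0: "0 \<le> W n" for n using vW[of n] nonneg(2)[of n] by linarith
  have S0: "0 \<le> S n" for n unfolding S_def by (rule partial_square_nonneg)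
  have S_Suc: "S (Suc n) powr p = S n powr p + d (Suc n) powr p" for n
    using p by (simp add: S_def partial_square_Suc)
  have inc: "S n \<le> S (Suc n)" for n
    by (rule powr_sum_root_bounds(1)[OF _ S0 S0 S_Suc nonneg(1)]) (use p in simp)
  have inc2: "(d (Suc n))\<^sup>2 \<le> 2 * S (Suc n) * (S (Suc n) - S n)" for n
    by (rule powr_increment_square_le[OF p S0 S0 S_Suc nonneg(1)])
  have step: "d (Suc k) * \<bar>v (Suc k) - v k\<bar> \<le> Q (Suc k) - Q k - S k * (v k / W k) * (v (Suc k) - v k)" for k
    unfolding Q_def
    by (rule weighted_increment_step[OF nonneg(2) vW nonneg(2) _ S0 inc nonneg(1) inc2]) (simp add: W_def)
  have "(\<Sum>k<N. d (Suc k) * \<bar>v (Suc k) - v k\<bar>)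
      \<le> (\<Sum>k<N. (Q (Suc k) - Q k) - S k * (v k / W k) * (v (Suc k) - v k))"
    by (intro sum_mono step)
  also have "\<dots> = Q N - Q 0 - (\<Sum>k<N. S k * (v k / W k) * (v (Suc k) - v k))"
    by (simp only: sum_subtractf[of "\<lambda>k. Q (Suc k) - Q k"] sum_lessThan_telescope)
  finally have sum_le: "(\<Sum>k<N. d (Suc k) * \<bar>v (Suc k) - v k\<bar>)
      \<le> Q N - Q 0 - (\<Sum>k<N. S k * (v k / W k) * (v (Suc k) - v k))" .
  have "0 \<le> Q 0" using S0 W0 by (simp add: Q_def)
  moreover have "Q N \<le> 5 / 2 * (S N * W N)"
  proof -
    have "(v N)\<^sup>2 / W N \<le> W N"
    proof (cases "W N = 0")
      case False
      then have "0 < W N" using W0[of N] by simp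
      then show ?thesis using power_mono[OF vW nonneg(2), of N 2] by (simp add: divide_le_eq power2_eq_square)
    qed simp
    then have "S N * (2 * W N + (v N)\<^sup>2 / W N) \<le> S N * (3 * W N)"
      using S0 by (intro mult_left_mono) auto
    then show ?thesis by (simp add: Q_def)
  qed
  ultimately show ?thesis using sum_le by linarith
qed

section \<open>Separably valued functions\<close>

text \<open>
Pointwise limits of measurable functions with values in one fixed countable set.  Unlike Borel
measurability, this notion is stable under sums and other continuous operations in nonseparable spaces.
Each approximating function is encoded by its measurable index \<open>J i\<close> into an enumeration \<open>q\<close>.
\<close>

definition strongly_measurable :: "'o measure \<Rightarrow> ('o \<Rightarrow> 'a::topological_space) \<Rightarrow> bool" where
  "strongly_measurable M f \<longleftrightarrow> (\<exists>(q :: nat \<Rightarrow> 'a) (J :: nat \<Rightarrow> 'o \<Rightarrow> nat).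
     (\<forall>i. J i \<in> measurable M (count_space UNIV)) \<and>
     (\<forall>\<omega>\<in>space M. (\<lambda>i. q (J i \<omega>)) \<longlonglongrightarrow> f \<omega>))"

text \<open>
Send each value to the first point of the dense sequence that is close enough.  Besides strong
measurability, this yields the countable partitions used in \<open>conditional_jensen_reflected\<close>; the
sequence \<open>q\<close> does not depend on the accuracy.
\<close>

lemma countably_valued_approximation:
  fixes f :: "'o \<Rightarrow> 'a::metric_space"
  assumes f: "f \<in> borel_measurable M" and Q: "countable Q" "f ` space M \<subseteq> closure Q"
  obtains q :: "nat \<Rightarrow> 'a"
  where "\<And>e. 0 < e \<Longrightarrow> \<exists>J\<in>measurable M (count_space UNIV). \<forall>\<omega>\<in>space M. dist (q (J \<omega>)) (f \<omega>) < e"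
proof
  let ?q = "from_nat_into Q"
  fix e :: real assume e: "0 < e"
  define J where "J = (\<lambda>\<omega>. LEAST k. dist (?q k) (f \<omega>) < e)"
  show "\<exists>J\<in>measurable M (count_space UNIV). \<forall>\<omega>\<in>space M. dist (?q (J \<omega>)) (f \<omega>) < e"
  proof (intro bexI[of _ J] ballI)
    fix \<omega> assume "\<omega> \<in> space M"
    then have "f \<omega> \<in> closure Q" using Q by auto
    then obtain y where y: "y \<in> Q" "dist y (f \<omega>) < e"
      using e by (auto simp: closure_approachable)
    then have "Q \<noteq> {}" by auto
    with y Q(1) obtain k where "?q k = y" by (metis from_nat_into_surj)
    with y have "dist (?q k) (f \<omega>) < e" by simp
    then show "dist (?q (J \<omega>)) (f \<omega>) < e" unfolding J_def by (rule LeastI)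
  next
    have [measurable]: "(\<lambda>\<omega>. dist c (f \<omega>)) \<in> borel_measurable M" for c
      by (intro measurable_compose[OF f borel_measurable_continuous_onI] continuous_intros)
    show "J \<in> measurable M (count_space UNIV)"
      unfolding J_def by measurable
  qed
qed

lemma strongly_measurable_separable:
  fixes f :: "'o \<Rightarrow> 'a::metric_space"
  assumes "f \<in> borel_measurable M" "countable Q" "f ` space M \<subseteq> closure Q"
  shows "strongly_measurable M f"
proof -
  obtain q :: "nat \<Rightarrow> 'a" where q:
    "\<And>e. 0 < e \<Longrightarrow> \<exists>J\<in>measurable M (count_space UNIV). \<forall>\<omega>\<in>space M. dist (q (J \<omega>)) (f \<omega>) < e"
    using countably_valued_approximation[OF assms] by blast
  have "\<exists>J\<in>measurable M (count_space UNIV). \<forall>\<omega>\<in>space M. dist (q (J \<omega>)) (f \<omega>) < inverse (real (Suc i))" for i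
    by (rule q) simp
  then obtain J where J: "\<And>i. J i \<in> measurable M (count_space UNIV)"
    "\<And>i \<omega>. \<omega> \<in> space M \<Longrightarrow> dist (q (J i \<omega>)) (f \<omega>) < inverse (real (Suc i))" by metis
  have "(\<lambda>i. q (J i \<omega>)) \<longlonglongrightarrow> f \<omega>" if "\<omega> \<in> space M" for \<omega>
  proof (rule tendstoI)
    fix e :: real assume "0 < e"
    then have "eventually (\<lambda>i. inverse (real (Suc i)) < e) sequentially"
      using order_tendstoD(2)[OF LIMSEQ_inverse_real_of_nat] by blast
    then show "eventually (\<lambda>i. dist (q (J i \<omega>)) (f \<omega>) < e) sequentially"
      by eventually_elim (use J(2)[OF that] in \<open>rule less_trans\<close>)
  qed
  with J(1) show ?thesis unfolding strongly_measurable_def by blast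
qed

lemma strongly_measurable_simple_function:
  fixes f :: "'o \<Rightarrow> 'a::metric_space"
  assumes "simple_function M f"
  shows "strongly_measurable M f"
proof (rule strongly_measurable_separable)
  show "f \<in> borel_measurable M" using assms by (rule borel_measurable_simple_function)
  show "countable (f ` space M)" using assms by (auto simp: simple_function_def countable_finite)
qed (rule closure_subset)

lemma strongly_measurable_compose2:
  assumes "strongly_measurable M f" "strongly_measurable M g"
    and h: "continuous_on UNIV (\<lambda>z. h (fst z) (snd z))"
  shows "strongly_measurable M (\<lambda>\<omega>. h (f \<omega>) (g \<omega>))"
proof -
  obtain q J where f: "\<And>i::nat. J i \<in> measurable M (count_space UNIV)"
    "\<And>\<omega>. \<omega> \<in> space M \<Longrightarrow> (\<lambda>i. q (J i \<omega> :: nat)) \<longlonglongrightarrow> f \<omega>"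
    using assms(1) unfolding strongly_measurable_def by blast
  obtain r K where g: "\<And>i::nat. K i \<in> measurable M (count_space UNIV)"
    "\<And>\<omega>. \<omega> \<in> space M \<Longrightarrow> (\<lambda>i. r (K i \<omega> :: nat)) \<longlonglongrightarrow> g \<omega>"
    using assms(2) unfolding strongly_measurable_def by blast
  note [measurable] = f(1) g(1)
  show ?thesis unfolding strongly_measurable_def
  proof (intro exI conjI allI ballI)
    show "(\<lambda>\<omega>. prod_encode (J i \<omega>, K i \<omega>)) \<in> measurable M (count_space UNIV)" for i
    proof -
      have "(\<lambda>\<omega>. (\<lambda>a b. prod_encode (a, b)) (J i \<omega>) (K i \<omega>)) \<in> measurable M (count_space UNIV)"
        by (rule measurable_compose_countable[OF measurable_compose_countable[OF _ g(1)] f(1)]) simp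
      then show ?thesis by simp
    qed
    fix \<omega> assume \<omega>: "\<omega> \<in> space M"
    have "(\<lambda>i. (\<lambda>z. h (fst z) (snd z)) (q (J i \<omega>), r (K i \<omega>))) \<longlonglongrightarrow> (\<lambda>z. h (fst z) (snd z)) (f \<omega>, g \<omega>)"
      by (intro continuous_on_tendsto_compose[OF h] tendsto_Pair f g \<omega>) auto
    then show "(\<lambda>i. (\<lambda>n. h (q (fst (prod_decode n))) (r (snd (prod_decode n)))) (prod_encode (J i \<omega>, K i \<omega>)))
        \<longlonglongrightarrow> h (f \<omega>) (g \<omega>)"
      by simp
  qed
qed

lemma strongly_measurable_diff:
  fixes f g :: "'o \<Rightarrow> 'a::real_normed_vector"
  shows "strongly_measurable M f \<Longrightarrow> strongly_measurable M g \<Longrightarrow> strongly_measurable M (\<lambda>\<omega>. f \<omega> - g \<omega>)"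
  by (rule strongly_measurable_compose2[where h="\<lambda>x y. x - y"]) (auto intro!: continuous_intros)

lemma strongly_measurable_scaleR:
  fixes f :: "'o \<Rightarrow> 'a::real_normed_vector"
  shows "strongly_measurable M r \<Longrightarrow> strongly_measurable M f \<Longrightarrow> strongly_measurable M (\<lambda>\<omega>. r \<omega> *\<^sub>R f \<omega>)"
  by (rule strongly_measurable_compose2[where h="\<lambda>x y. x *\<^sub>R y"]) (auto intro!: continuous_intros)

lemma strongly_measurable_const: "strongly_measurable M (\<lambda>_. c)"
  unfolding strongly_measurable_def by (intro exI[of _ "\<lambda>_. c"] exI[of _ "\<lambda>_ _. 0"]) simp

lemma strongly_measurable_imp_borel:
  fixes f :: "'o \<Rightarrow> real"
  assumes "strongly_measurable M f"
  shows "f \<in> borel_measurable M"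
proof -
  obtain q J where f: "\<And>i::nat. J i \<in> measurable M (count_space UNIV)"
    "\<And>\<omega>. \<omega> \<in> space M \<Longrightarrow> (\<lambda>i. q (J i \<omega> :: nat)) \<longlonglongrightarrow> f \<omega>"
    using assms(1) unfolding strongly_measurable_def by blast
  show ?thesis
    by (rule borel_measurable_LIMSEQ_real[OF f(2)]) (auto intro: measurable_compose[OF f(1)])
qed

lemma strongly_measurable_norm_borel:
  fixes f :: "'o \<Rightarrow> 'a::real_normed_vector"
  assumes "strongly_measurable M f"
  shows "(\<lambda>\<omega>. norm (f \<omega>)) \<in> borel_measurable M"
  by (rule strongly_measurable_imp_borel,
      rule strongly_measurable_compose2[where h="\<lambda>x y. norm x", OF assms assms]) (intro continuous_intros)

lemma strongly_measurable_subalgebra: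
  assumes "strongly_measurable G f" "subalgebra M G"
  shows "strongly_measurable M f"
proof -
  have "J \<in> measurable M (count_space UNIV)" if "J \<in> measurable G (count_space UNIV)" for J :: "'a \<Rightarrow> nat"
    using that assms(2) by (rule measurable_from_subalg[rotated])
  then show ?thesis
    using assms unfolding strongly_measurable_def subalgebra_def by metis
qed

text \<open>
The simple functions that approximate \<open>f\<close> take countably many values altogether, and the distance of
\<open>f\<close> to this countable set has integral zero.
\<close>

lemma has_bint_essentially_separable:
  fixes f :: "'o \<Rightarrow> 'b::banach"
  assumes "has_bint M f x"
  obtains Q where "countable Q" "AE \<omega> in M. f \<omega> \<in> closure Q"
proof -
  obtain s where f[measurable]: "f \<in> borel_measurable M"
    and s: "\<And>i. Bochner_Integration.simple_bochner_integrable M (s i)"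
    and lim: "(\<lambda>i. \<integral>\<^sup>+\<omega>. ennreal (norm (f \<omega> - s i \<omega>)) \<partial>M) \<longlonglongrightarrow> 0"
    using assms unfolding has_bint_def by blast
  define Q where "Q = insert 0 (\<Union>i::nat. s i ` space M)"
  have "finite (s i ` space M)" for i
    using s[of i] by (auto simp: simple_function_def elim: simple_bochner_integrable.cases)
  then have Q: "countable Q" by (auto simp: Q_def intro: countable_finite)
  have Qne: "Q \<noteq> {}" by (simp add: Q_def)
  let ?q = "from_nat_into Q"
  define d where "d = (\<lambda>\<omega>. INF k. ennreal (norm (f \<omega> - ?q k)))"
  have [measurable]: "(\<lambda>\<omega>. norm (f \<omega> - c)) \<in> borel_measurable M" for c
    by (intro measurable_compose[OF f borel_measurable_continuous_onI] continuous_intros)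
  have [measurable]: "d \<in> borel_measurable M" unfolding d_def by measurable
  have "(\<integral>\<^sup>+\<omega>. d \<omega> \<partial>M) \<le> (\<integral>\<^sup>+\<omega>. ennreal (norm (f \<omega> - s i \<omega>)) \<partial>M)" for i
  proof (rule nn_integral_mono)
    fix \<omega> assume "\<omega> \<in> space M"
    then have "s i \<omega> \<in> Q" by (auto simp: Q_def)
    with Q Qne obtain k where "?q k = s i \<omega>" by (metis from_nat_into_surj)
    then show "d \<omega> \<le> ennreal (norm (f \<omega> - s i \<omega>))"
      unfolding d_def by (metis INF_lower UNIV_I)
  qed
  then have "(\<integral>\<^sup>+\<omega>. d \<omega> \<partial>M) \<le> 0"
    by (intro LIMSEQ_le_const[OF lim]) auto
  then have "AE \<omega> in M. d \<omega> = 0" by (simp add: nn_integral_0_iff_AE)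
  then have "AE \<omega> in M. f \<omega> \<in> closure Q"
  proof eventually_elim
    case (elim \<omega>)
    show ?case unfolding closure_approachable
    proof (intro allI impI)
      fix e :: real assume "0 < e"
      then have "d \<omega> < ennreal e" using elim by simp
      then obtain k where "ennreal (norm (f \<omega> - ?q k)) < ennreal e"
        unfolding d_def by (auto simp: INF_less_iff)
      then have "dist (?q k) (f \<omega>) < e"
        using \<open>0 < e\<close> by (simp add: dist_norm norm_minus_commute ennreal_less_iff)
      then show "\<exists>y\<in>Q. dist y (f \<omega>) < e" using from_nat_into[OF Qne] by blast
    qed
  qed
  with Q that show thesis by blast
qed

lemma separable_version:
  fixes f :: "'o \<Rightarrow> 'b::banach"
  assumes "has_bint M f x" "f \<in> borel_measurable G" "subalgebra M G"
  obtains g Q where "g \<in> borel_measurable G" "countable Q" "g ` space G \<subseteq> closure Q" "AE \<omega> in M. f \<omega> = g \<omega>"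
proof -
  obtain Q where Q: "countable Q" "AE \<omega> in M. f \<omega> \<in> closure Q"
    using has_bint_essentially_separable[OF assms(1)] by blast
  define g where "g = (\<lambda>\<omega>. if f \<omega> \<in> closure Q then f \<omega> else 0)"
  have "{\<omega> \<in> space G. f \<omega> \<in> closure Q} \<in> sets G"
    using measurable_sets[OF assms(2), of "closure Q"] by (simp add: vimage_def Int_def conj_commute)
  then have "g \<in> borel_measurable G"
    unfolding g_def using assms(2) by (intro measurable_If) auto
  moreover have "countable (insert 0 Q)" using Q by simp
  moreover have "g ` space G \<subseteq> closure (insert 0 Q)"
    using closure_subset[of "insert 0 Q"] closure_mono[of Q "insert 0 Q"] by (auto simp: g_def)
  moreover have "AE \<omega> in M. f \<omega> = g \<omega>"
    using Q(2) by eventually_elim (simp add: g_def)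
  ultimately show thesis by (rule that)
qed

text \<open>
If \<open>f\<close> and \<open>g\<close> have the same integral over \<open>A\<close>, then \<open>c - (f - g)\<close> has integral \<open>c P(A)\<close> over \<open>A\<close>,
and the norm of an integral is at most the integral of the norm.  The argument runs through the
approximating simple functions, since \<open>f\<close> and \<open>g\<close> themselves may have a difference that is not Borel.
\<close>

lemma norm_le_nn_integral_diff:
  fixes f g f' g' :: "'o \<Rightarrow> 'b::banach"
  assumes "prob_space M"
    and f: "has_bint M (\<lambda>\<omega>. indicator A \<omega> *\<^sub>R f \<omega>) x" and g: "has_bint M (\<lambda>\<omega>. indicator A \<omega> *\<^sub>R g \<omega>) x"
    and AE: "AE \<omega> in M. f \<omega> = f' \<omega>" "AE \<omega> in M. g \<omega> = g' \<omega>"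
    and f': "strongly_measurable M f'" and g': "strongly_measurable M g'" and A[measurable]: "A \<in> sets M"
  shows "ennreal (norm c) * emeasure M A
    \<le> (\<integral>\<^sup>+\<omega>. ennreal (norm (c - (f' \<omega> - g' \<omega>))) * indicator A \<omega> \<partial>M)"
proof -
  interpret prob_space M by fact
  obtain s where
    s: "\<And>i. Bochner_Integration.simple_bochner_integrable M (s i)"
    and s_lim: "(\<lambda>i. \<integral>\<^sup>+\<omega>. ennreal (norm (indicator A \<omega> *\<^sub>R f \<omega> - s i \<omega>)) \<partial>M) \<longlonglongrightarrow> 0"
    and s_x: "(\<lambda>i. Bochner_Integration.simple_bochner_integral M (s i)) \<longlonglongrightarrow> x"
    using f unfolding has_bint_def by blast
  obtain r where
    r: "\<And>i. Bochner_Integration.simple_bochner_integrable M (r i)"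
    and r_lim: "(\<lambda>i. \<integral>\<^sup>+\<omega>. ennreal (norm (indicator A \<omega> *\<^sub>R g \<omega> - r i \<omega>)) \<partial>M) \<longlonglongrightarrow> 0"
    and r_x: "(\<lambda>i. Bochner_Integration.simple_bochner_integral M (r i)) \<longlonglongrightarrow> x"
    using g unfolding has_bint_def by blast
  have sm: "strongly_measurable M (s i)" "strongly_measurable M (r i)" for i
    using s[of i] r[of i] by (auto intro: strongly_measurable_simple_function elim: simple_bochner_integrable.cases)
  have smA: "strongly_measurable M (indicator A :: 'o \<Rightarrow> real)"
    by (intro strongly_measurable_simple_function) auto
  have smAf: "strongly_measurable M (\<lambda>\<omega>. indicator A \<omega> *\<^sub>R f' \<omega>)" "strongly_measurable M (\<lambda>\<omega>. indicator A \<omega> *\<^sub>R g' \<omega>)"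
    by (intro strongly_measurable_scaleR smA f' g')+
  have [measurable]: "(\<lambda>\<omega>. norm (indicator A \<omega> *\<^sub>R f' \<omega> - s i \<omega>)) \<in> borel_measurable M"
    "(\<lambda>\<omega>. norm (indicator A \<omega> *\<^sub>R g' \<omega> - r i \<omega>)) \<in> borel_measurable M"
    "(\<lambda>\<omega>. norm (c - (f' \<omega> - g' \<omega>))) \<in> borel_measurable M" for i
    by (intro strongly_measurable_norm_borel strongly_measurable_diff strongly_measurable_const sm smAf f' g')+
  let ?u = "\<lambda>i. \<integral>\<^sup>+\<omega>. ennreal (norm (indicator A \<omega> *\<^sub>R f' \<omega> - s i \<omega>)) \<partial>M"
  let ?v = "\<lambda>i. \<integral>\<^sup>+\<omega>. ennreal (norm (indicator A \<omega> *\<^sub>R g' \<omega> - r i \<omega>)) \<partial>M"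
  let ?I = "\<integral>\<^sup>+\<omega>. ennreal (norm (c - (f' \<omega> - g' \<omega>))) * indicator A \<omega> \<partial>M"
  have "(\<integral>\<^sup>+\<omega>. ennreal (norm (indicator A \<omega> *\<^sub>R f \<omega> - s i \<omega>)) \<partial>M) = ?u i" for i
    by (rule nn_integral_cong_AE) (use AE(1) in eventually_elim, simp)
  with s_lim have u: "?u \<longlonglongrightarrow> 0" by simp
  have "(\<integral>\<^sup>+\<omega>. ennreal (norm (indicator A \<omega> *\<^sub>R g \<omega> - r i \<omega>)) \<partial>M) = ?v i" for i
    by (rule nn_integral_cong_AE) (use AE(2) in eventually_elim, simp)
  with r_lim have v: "?v \<longlonglongrightarrow> 0" by simp
  let ?SI = "Bochner_Integration.simple_bochner_integral M"
  define k where "k = (\<lambda>\<omega>. indicator A \<omega> *\<^sub>R c)"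
  have k: "Bochner_Integration.simple_bochner_integrable M k"
    unfolding k_def
    by (intro simple_bochner_integrable.intros simple_function_compose1[where g="\<lambda>x. x *\<^sub>R c"])
       (auto simp: emeasure_eq_measure)
  have k_int: "?SI k = measure M A *\<^sub>R c"
  proof -
    have "?SI (\<lambda>\<omega>. (\<lambda>t::real. t *\<^sub>R c) (indicator A \<omega>)) = (\<lambda>t. t *\<^sub>R c) (?SI (indicator A))"
    proof (rule simple_bochner_integral_linear)
      show "linear (\<lambda>t::real. t *\<^sub>R c)" by (rule linearI) (auto simp: scaleR_add_left)
      show "Bochner_Integration.simple_bochner_integrable M (indicator A :: 'o \<Rightarrow> real)"
        by (intro simple_bochner_integrable.intros) (auto simp: emeasure_eq_measure)
    qed
    also have "?SI (indicator A :: 'o \<Rightarrow> real) = measure M A"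
    proof -
      have "has_bochner_integral M (indicator A :: 'o \<Rightarrow> real) (?SI (indicator A))"
        by (intro has_bochner_integral_simple_bochner_integrable simple_bochner_integrable.intros)
           (auto simp: emeasure_eq_measure)
      moreover have "has_bochner_integral M (indicator A :: 'o \<Rightarrow> real) (measure M A)"
        by (intro has_bochner_integral_real_indicator) (auto simp: emeasure_eq_measure)
      ultimately show ?thesis by (rule has_bochner_integral_eq)
    qed
    finally show ?thesis by (simp add: k_def)
  qed
  have bound: "ennreal (norm (?SI k - (?SI (s i) - ?SI (r i)))) \<le> ?I + ?u i + ?v i" for i
  proof -
    let ?z = "\<lambda>\<omega>. k \<omega> - (s i \<omega> - r i \<omega>)"
    have sr: "Bochner_Integration.simple_bochner_integrable M (\<lambda>\<omega>. s i \<omega> - r i \<omega>)"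
      by (rule simple_bochner_integrable_compose2[OF _ s r]) simp
    have z: "Bochner_Integration.simple_bochner_integrable M ?z"
      by (rule simple_bochner_integrable_compose2[OF _ k sr]) simp
    have nz: "Bochner_Integration.simple_bochner_integrable M (\<lambda>\<omega>. norm (?z \<omega>))"
      by (rule simple_bochner_integrable_compose2[of "\<lambda>x y. norm x", OF _ z z]) simp
    have "?SI ?z = ?SI k - (?SI (s i) - ?SI (r i))"
      by (simp add: simple_bochner_integral_diff[OF k sr] simple_bochner_integral_diff[OF s r])
    then have "ennreal (norm (?SI k - (?SI (s i) - ?SI (r i)))) \<le> ennreal (?SI (\<lambda>\<omega>. norm (?z \<omega>)))"
      using simple_bochner_integral_norm_bound[OF z] by (simp add: ennreal_leI)
    also have "\<dots> = (\<integral>\<^sup>+\<omega>. norm (?z \<omega>) \<partial>M)"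
      by (rule simple_bochner_integral_eq_nn_integral[OF nz]) simp
    also have "\<dots> \<le> (\<integral>\<^sup>+\<omega>. ennreal (norm (c - (f' \<omega> - g' \<omega>))) * indicator A \<omega>
        + ennreal (norm (indicator A \<omega> *\<^sub>R f' \<omega> - s i \<omega>)) + ennreal (norm (indicator A \<omega> *\<^sub>R g' \<omega> - r i \<omega>)) \<partial>M)"
    proof (rule nn_integral_mono)
      fix \<omega>
      have "?z \<omega> = indicator A \<omega> *\<^sub>R (c - (f' \<omega> - g' \<omega>)) + (indicator A \<omega> *\<^sub>R f' \<omega> - s i \<omega>) - (indicator A \<omega> *\<^sub>R g' \<omega> - r i \<omega>)"
        by (simp add: k_def algebra_simps)
      moreover have "norm (a + b - d) \<le> norm a + norm b + norm d" for a b d :: 'b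
        using norm_triangle_ineq4[of "a + b" d] norm_triangle_ineq[of a b] by linarith
      ultimately have "norm (?z \<omega>) \<le> norm (indicator A \<omega> *\<^sub>R (c - (f' \<omega> - g' \<omega>))) + norm (indicator A \<omega> *\<^sub>R f' \<omega> - s i \<omega>)
          + norm (indicator A \<omega> *\<^sub>R g' \<omega> - r i \<omega>)"
        by metis
      also have "norm (indicator A \<omega> *\<^sub>R (c - (f' \<omega> - g' \<omega>))) = norm (c - (f' \<omega> - g' \<omega>)) * indicator A \<omega>"
        by (simp add: mult.commute)
      finally have "norm (?z \<omega>) \<le> norm (c - (f' \<omega> - g' \<omega>)) * indicator A \<omega> + norm (indicator A \<omega> *\<^sub>R f' \<omega> - s i \<omega>)
          + norm (indicator A \<omega> *\<^sub>R g' \<omega> - r i \<omega>)" .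
      then have "ennreal (norm (?z \<omega>)) \<le> ennreal (norm (c - (f' \<omega> - g' \<omega>)) * indicator A \<omega> + norm (indicator A \<omega> *\<^sub>R f' \<omega> - s i \<omega>)
          + norm (indicator A \<omega> *\<^sub>R g' \<omega> - r i \<omega>))" by (rule ennreal_leI)
      then show "ennreal (norm (?z \<omega>)) \<le> ennreal (norm (c - (f' \<omega> - g' \<omega>))) * indicator A \<omega>
        + ennreal (norm (indicator A \<omega> *\<^sub>R f' \<omega> - s i \<omega>)) + ennreal (norm (indicator A \<omega> *\<^sub>R g' \<omega> - r i \<omega>))"
        by (cases "\<omega> \<in> A"; simp)
    qed
    also have "\<dots> = ?I + ?u i + ?v i"
      by (simp add: nn_integral_add)
    finally show ?thesis .
  qed
  have "(\<lambda>i. norm (?SI k - (?SI (s i) - ?SI (r i)))) \<longlonglongrightarrow> norm (?SI k - (x - x))"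
    by (intro tendsto_intros s_x r_x)
  then have lim: "(\<lambda>i. ennreal (norm (?SI k - (?SI (s i) - ?SI (r i))))) \<longlonglongrightarrow> ennreal (norm c * measure M A)"
    by (intro tendsto_ennrealI) (simp add: k_int mult.commute)
  have "(\<lambda>i. ?I + ?u i + ?v i) \<longlonglongrightarrow> ?I + 0 + 0"
    by (intro tendsto_add tendsto_const u v)
  from LIMSEQ_le[OF lim this] bound have "ennreal (norm c * measure M A) \<le> ?I" by auto
  then show ?thesis by (simp add: ennreal_mult' emeasure_eq_measure)
qed

section \<open>The conditional triangle inequality for a reflected step\<close>

text \<open>
One of the approximating simple functions is at distance less than \<open>1\<close> in mean, and its norm has
finite integral.
\<close>

lemma has_bint_nn_integral_norm_finite:
  fixes f f' :: "'o \<Rightarrow> 'b::banach"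
  assumes "has_bint M f x" and AE: "AE \<omega> in M. f \<omega> = f' \<omega>" and f': "strongly_measurable M f'"
  shows "(\<integral>\<^sup>+\<omega>. ennreal (norm (f' \<omega>)) \<partial>M) < \<infinity>"
proof -
  obtain s where s: "\<And>i. Bochner_Integration.simple_bochner_integrable M (s i)"
    and lim: "(\<lambda>i. \<integral>\<^sup>+\<omega>. ennreal (norm (f \<omega> - s i \<omega>)) \<partial>M) \<longlonglongrightarrow> 0"
    using assms(1) unfolding has_bint_def by blast
  have "eventually (\<lambda>i. (\<integral>\<^sup>+\<omega>. ennreal (norm (f \<omega> - s i \<omega>)) \<partial>M) < 1) sequentially"
    using order_tendstoD(2)[OF lim, of 1] by simp
  then obtain i where i: "(\<integral>\<^sup>+\<omega>. ennreal (norm (f \<omega> - s i \<omega>)) \<partial>M) < 1"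
    by (auto simp: eventually_sequentially)
  have eq: "(\<integral>\<^sup>+\<omega>. ennreal (norm (f \<omega> - s i \<omega>)) \<partial>M) = (\<integral>\<^sup>+\<omega>. ennreal (norm (f' \<omega> - s i \<omega>)) \<partial>M)"
    by (rule nn_integral_cong_AE) (use AE in eventually_elim, simp)
  have sm: "strongly_measurable M (s i)"
    using s[of i] by (auto intro: strongly_measurable_simple_function elim: simple_bochner_integrable.cases)
  have [measurable]: "(\<lambda>\<omega>. norm (f' \<omega> - s i \<omega>)) \<in> borel_measurable M" "(\<lambda>\<omega>. norm (s i \<omega>)) \<in> borel_measurable M"
    by (intro strongly_measurable_norm_borel strongly_measurable_diff f' sm)+
  have "Bochner_Integration.simple_bochner_integrable M (\<lambda>\<omega>. norm (s i \<omega>))"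
    by (rule simple_bochner_integrable_compose2[of "\<lambda>x y. norm x", OF _ s s]) simp
  then have fin: "(\<integral>\<^sup>+\<omega>. ennreal (norm (s i \<omega>)) \<partial>M) < \<infinity>"
    using simple_bochner_integral_eq_nn_integral[of M "\<lambda>\<omega>. norm (s i \<omega>)"]
    by (metis ennreal_less_top infinity_ennreal_def norm_ge_zero)
  have "(\<integral>\<^sup>+\<omega>. ennreal (norm (f' \<omega>)) \<partial>M) \<le> (\<integral>\<^sup>+\<omega>. ennreal (norm (f' \<omega> - s i \<omega>)) + ennreal (norm (s i \<omega>)) \<partial>M)"
  proof (rule nn_integral_mono)
    fix \<omega>
    have "norm (f' \<omega>) \<le> norm (f' \<omega> - s i \<omega>) + norm (s i \<omega>)" by norm
    then show "ennreal (norm (f' \<omega>)) \<le> ennreal (norm (f' \<omega> - s i \<omega>)) + ennreal (norm (s i \<omega>))"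
      by (simp add: ennreal_leI flip: ennreal_plus)
  qed
  also have "\<dots> = (\<integral>\<^sup>+\<omega>. ennreal (norm (f' \<omega> - s i \<omega>)) \<partial>M) + (\<integral>\<^sup>+\<omega>. ennreal (norm (s i \<omega>)) \<partial>M)"
    by (rule nn_integral_add) auto
  also have "\<dots> < \<infinity>" using i eq fin by (auto simp: ennreal_add_less_top less_top[symmetric] dest: order.strict_trans)
  finally show ?thesis .
qed

text \<open>
The conditional Jensen inequality \<open>|g| \<le> E(|g - (f - g)| | G)\<close> for \<open>g = E(f | G)\<close>.  On a set in \<open>G\<close>
where \<open>g\<close> is within \<open>e\<close> of a constant \<open>c\<close>, it is \<open>norm_le_nn_integral_diff\<close> up to an error \<open>2 e\<close>.
Separability of the range of \<open>g\<close> provides a countable partition into such sets.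
\<close>

lemma conditional_jensen_reflected:
  fixes f g f' g' :: "'o \<Rightarrow> 'b::banach"
  assumes M: "prob_space M" and G: "subalgebra M G"
    and cond: "\<And>A. A \<in> sets G \<Longrightarrow> \<exists>x. has_bint M (\<lambda>\<omega>. indicator A \<omega> *\<^sub>R f \<omega>) x \<and> has_bint M (\<lambda>\<omega>. indicator A \<omega> *\<^sub>R g \<omega>) x"
    and AE: "AE \<omega> in M. f \<omega> = f' \<omega>" "AE \<omega> in M. g \<omega> = g' \<omega>"
    and f': "strongly_measurable M f'"
    and g': "g' \<in> borel_measurable G" "countable Q" "g' ` space G \<subseteq> closure Q"
    and A: "A \<in> sets G"
  shows "(\<integral>\<^sup>+\<omega>. ennreal (norm (g' \<omega>)) * indicator A \<omega> \<partial>M)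
    \<le> (\<integral>\<^sup>+\<omega>. ennreal (norm (g' \<omega> - (f' \<omega> - g' \<omega>))) * indicator A \<omega> \<partial>M)"
proof -
  interpret prob_space M by fact
  have sp: "space G = space M" and sub: "\<And>B. B \<in> sets G \<Longrightarrow> B \<in> sets M"
    using G by (auto simp: subalgebra_def)
  have g'm: "strongly_measurable M g'"
    using strongly_measurable_subalgebra[OF strongly_measurable_separable[OF g'] G] .
  have mv[measurable]: "(\<lambda>\<omega>. norm (g' \<omega> - (f' \<omega> - g' \<omega>))) \<in> borel_measurable M" 
    and mg[measurable]: "(\<lambda>\<omega>. norm (g' \<omega>)) \<in> borel_measurable M"
    by (intro strongly_measurable_norm_borel strongly_measurable_diff f' g'm)+
  let ?v = "\<lambda>\<omega>. norm (g' \<omega> - (f' \<omega> - g' \<omega>))"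
  have A'[measurable]: "A \<in> sets M" using A sub by auto
  obtain q :: "nat \<Rightarrow> 'b" where q:
    "\<And>e. 0 < e \<Longrightarrow> \<exists>J\<in>measurable G (count_space UNIV). \<forall>\<omega>\<in>space G. dist (q (J \<omega>)) (g' \<omega>) < e"
    using countably_valued_approximation[OF g'] by blast
  have main: "(\<integral>\<^sup>+\<omega>. ennreal (norm (g' \<omega>)) * indicator A \<omega> \<partial>M)
    \<le> (\<integral>\<^sup>+\<omega>. ennreal (?v \<omega>) * indicator A \<omega> \<partial>M) + ennreal (2 * e)" if e: "0 < e" for e
  proof -
    obtain J where J: "J \<in> measurable G (count_space UNIV)"
      "\<And>\<omega>. \<omega> \<in> space M \<Longrightarrow> norm (q (J \<omega>) - g' \<omega>) < e"
      using q[OF e] sp by (auto simp: dist_norm)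
    define B where "B = (\<lambda>k. A \<inter> {\<omega> \<in> space G. J \<omega> = k})"
    have BG: "B k \<in> sets G" for k
    proof -
      have "J -` {k} \<inter> space G \<in> sets G" by (rule measurable_sets[OF J(1)]) simp
      then have "A \<inter> (J -` {k} \<inter> space G) \<in> sets G" using A by (rule sets.Int[rotated])
      moreover have "A \<inter> (J -` {k} \<inter> space G) = B k" by (auto simp: B_def)
      ultimately show ?thesis by simp
    qed
    then have BM[measurable]: "B k \<in> sets M" for k using sub by auto
    have UB: "(\<Union>k. B k) = A" using sets.sets_into_space[OF A] by (auto simp: B_def)
    have disj: "disjoint_family B" by (auto simp: disjoint_family_on_def B_def)
    have piece: "(\<integral>\<^sup>+\<omega>. ennreal (norm (g' \<omega>)) * indicator (B k) \<omega> \<partial>M)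
        \<le> (\<integral>\<^sup>+\<omega>. ennreal (?v \<omega> + 2 * e) * indicator (B k) \<omega> \<partial>M)" for k
    proof -
      obtain x where x: "has_bint M (\<lambda>\<omega>. indicator (B k) \<omega> *\<^sub>R f \<omega>) x" "has_bint M (\<lambda>\<omega>. indicator (B k) \<omega> *\<^sub>R g \<omega>) x"
        using cond[OF BG] by blast
      have near: "norm (q k - g' \<omega>) < e" if "\<omega> \<in> B k" for \<omega>
        using that J(2)[of \<omega>] sp by (auto simp: B_def)
      have [measurable]: "(\<lambda>\<omega>. norm (q k - (f' \<omega> - g' \<omega>))) \<in> borel_measurable M"
        by (intro strongly_measurable_norm_borel strongly_measurable_diff strongly_measurable_const f' g'm)+
      have "(\<integral>\<^sup>+\<omega>. ennreal (norm (g' \<omega>)) * indicator (B k) \<omega> \<partial>M)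
          \<le> (\<integral>\<^sup>+\<omega>. (ennreal (norm (q k)) + ennreal e) * indicator (B k) \<omega> \<partial>M)"
      proof (rule nn_integral_mono)
        fix \<omega>
        have "norm (g' \<omega>) \<le> norm (q k) + e" if "\<omega> \<in> B k"
          using near[OF that] norm_triangle_sub[of "g' \<omega>" "q k"] by (simp add: norm_minus_commute)
        then show "ennreal (norm (g' \<omega>)) * indicator (B k) \<omega> \<le> (ennreal (norm (q k)) + ennreal e) * indicator (B k) \<omega>"
          using e by (auto split: split_indicator simp flip: ennreal_plus intro!: ennreal_leI)
      qed
      also have "\<dots> = ennreal (norm (q k)) * emeasure M (B k) + ennreal e * emeasure M (B k)"
        by (simp add: nn_integral_cmult_indicator nn_integral_add distrib_right)
      also have "\<dots> \<le> (\<integral>\<^sup>+\<omega>. ennreal (norm (q k - (f' \<omega> - g' \<omega>))) * indicator (B k) \<omega> \<partial>M) + ennreal e * emeasure M (B k)"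
        by (intro add_right_mono norm_le_nn_integral_diff[OF M x AE f' g'm BM])
      also have "ennreal e * emeasure M (B k) = (\<integral>\<^sup>+\<omega>. ennreal e * indicator (B k) \<omega> \<partial>M)"
        by (simp add: nn_integral_cmult_indicator)
      also have "(\<integral>\<^sup>+\<omega>. ennreal (norm (q k - (f' \<omega> - g' \<omega>))) * indicator (B k) \<omega> \<partial>M) + (\<integral>\<^sup>+\<omega>. ennreal e * indicator (B k) \<omega> \<partial>M)
          = (\<integral>\<^sup>+\<omega>. ennreal (norm (q k - (f' \<omega> - g' \<omega>))) * indicator (B k) \<omega> + ennreal e * indicator (B k) \<omega> \<partial>M)"
        by (rule nn_integral_add[symmetric]) auto
      also have "\<dots> \<le> (\<integral>\<^sup>+\<omega>. ennreal (?v \<omega> + 2 * e) * indicator (B k) \<omega> \<partial>M)"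
      proof (rule nn_integral_mono)
        fix \<omega>
        have "norm (q k - (f' \<omega> - g' \<omega>)) + e \<le> ?v \<omega> + 2 * e" if "\<omega> \<in> B k"
        proof -
          have "q k - (f' \<omega> - g' \<omega>) = (q k - g' \<omega>) + (g' \<omega> - (f' \<omega> - g' \<omega>))" by simp
          then have "norm (q k - (f' \<omega> - g' \<omega>)) \<le> norm (q k - g' \<omega>) + ?v \<omega>" by (metis norm_triangle_ineq)
          then show ?thesis using near[OF that] by linarith
        qed
        then show "ennreal (norm (q k - (f' \<omega> - g' \<omega>))) * indicator (B k) \<omega> + ennreal e * indicator (B k) \<omega> \<le> ennreal (?v \<omega> + 2 * e) * indicator (B k) \<omega>"
          using e by (auto split: split_indicator simp flip: ennreal_plus intro!: ennreal_leI)
      qed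
      finally show ?thesis .
    qed
    have split: "(\<integral>\<^sup>+\<omega>. u \<omega> * indicator A \<omega> \<partial>M) = (\<Sum>k. \<integral>\<^sup>+\<omega>. u \<omega> * indicator (B k) \<omega> \<partial>M)"
      if "u \<in> borel_measurable M" for u :: "'o \<Rightarrow> ennreal"
      using nn_integral_disjoint_family[OF that BM disj] UB by simp
    have "(\<integral>\<^sup>+\<omega>. ennreal (norm (g' \<omega>)) * indicator A \<omega> \<partial>M) = (\<Sum>k. \<integral>\<^sup>+\<omega>. ennreal (norm (g' \<omega>)) * indicator (B k) \<omega> \<partial>M)"
      by (rule split) auto
    also have "\<dots> \<le> (\<Sum>k. \<integral>\<^sup>+\<omega>. ennreal (?v \<omega> + 2 * e) * indicator (B k) \<omega> \<partial>M)"
      by (intro suminf_le piece) auto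
    also have "\<dots> = (\<integral>\<^sup>+\<omega>. ennreal (?v \<omega> + 2 * e) * indicator A \<omega> \<partial>M)"
      by (rule split[symmetric]) auto
    also have "\<dots> = (\<integral>\<^sup>+\<omega>. ennreal (?v \<omega>) * indicator A \<omega> + ennreal (2 * e) * indicator A \<omega> \<partial>M)"
      using e by (intro nn_integral_cong) (auto split: split_indicator)
    also have "\<dots> = (\<integral>\<^sup>+\<omega>. ennreal (?v \<omega>) * indicator A \<omega> \<partial>M) + (\<integral>\<^sup>+\<omega>. ennreal (2 * e) * indicator A \<omega> \<partial>M)"
      by (rule nn_integral_add) auto
    also have "(\<integral>\<^sup>+\<omega>. ennreal (2 * e) * indicator A \<omega> \<partial>M) = ennreal (2 * e) * emeasure M A"
      by (simp add: nn_integral_cmult_indicator)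
    also have "\<dots> \<le> ennreal (2 * e) * 1"
      by (intro mult_left_mono) (auto simp: emeasure_le_1)
    finally show ?thesis by simp
  qed
  show ?thesis
  proof (rule ennreal_le_epsilon)
    fix e :: real assume "0 < e"
    then show "(\<integral>\<^sup>+\<omega>. ennreal (norm (g' \<omega>)) * indicator A \<omega> \<partial>M)
      \<le> (\<integral>\<^sup>+\<omega>. ennreal (norm (g' \<omega> - (f' \<omega> - g' \<omega>))) * indicator A \<omega> \<partial>M) + ennreal e"
      using main[of "e / 2"] by simp
  qed
qed

text \<open>
An inequality between integrals over all sets of \<open>G\<close> extends to nonnegative \<open>G\<close>-measurable factors by
the standard induction over such functions.
\<close>

lemma nn_integral_mult_mono_subalgebra:
  fixes u v :: "'o \<Rightarrow> ennreal"
  assumes G: "subalgebra M G"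
    and [measurable]: "u \<in> borel_measurable M" "v \<in> borel_measurable M"
    and sets: "\<And>A. A \<in> sets G \<Longrightarrow> (\<integral>\<^sup>+\<omega>. u \<omega> * indicator A \<omega> \<partial>M) \<le> (\<integral>\<^sup>+\<omega>. v \<omega> * indicator A \<omega> \<partial>M)"
    and Y: "Y \<in> borel_measurable G"
  shows "(\<integral>\<^sup>+\<omega>. u \<omega> * Y \<omega> \<partial>M) \<le> (\<integral>\<^sup>+\<omega>. v \<omega> * Y \<omega> \<partial>M)"
  using Y
proof (induct Y rule: borel_measurable_induct)
  case (cong f g)
  then have "\<And>\<omega>. \<omega> \<in> space M \<Longrightarrow> f \<omega> = g \<omega>" using G by (auto simp: subalgebra_def)
  then have "(\<integral>\<^sup>+\<omega>. u \<omega> * f \<omega> \<partial>M) = (\<integral>\<^sup>+\<omega>. u \<omega> * g \<omega> \<partial>M)"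
    "(\<integral>\<^sup>+\<omega>. v \<omega> * f \<omega> \<partial>M) = (\<integral>\<^sup>+\<omega>. v \<omega> * g \<omega> \<partial>M)" by (auto intro!: nn_integral_cong)
  then show ?case using cong by simp
next
  case (set A)
  then show ?case by (rule sets)
next
  case (mult Z c)
  have [measurable]: "Z \<in> borel_measurable M" by (rule measurable_from_subalg[OF G mult(2)])
  have "(\<integral>\<^sup>+\<omega>. t \<omega> * (c * Z \<omega>) \<partial>M) = c * (\<integral>\<^sup>+\<omega>. t \<omega> * Z \<omega> \<partial>M)"
    if [measurable]: "t \<in> borel_measurable M" for t
    by (subst nn_integral_cmult[symmetric]) (auto simp: mult_ac)
  then show ?case using mult by (simp add: mult_left_mono)
next
  case (add Z Y)
  have [measurable]: "Z \<in> borel_measurable M" "Y \<in> borel_measurable M"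
    by (rule measurable_from_subalg[OF G add(1)] measurable_from_subalg[OF G add(4)])+
  have "(\<integral>\<^sup>+\<omega>. t \<omega> * (Y \<omega> + Z \<omega>) \<partial>M) = (\<integral>\<^sup>+\<omega>. t \<omega> * Y \<omega> \<partial>M) + (\<integral>\<^sup>+\<omega>. t \<omega> * Z \<omega> \<partial>M)"
    if [measurable]: "t \<in> borel_measurable M" for t
    by (subst nn_integral_add[symmetric]) (auto simp: distrib_left)
  then show ?case using add by (simp add: add_mono)
next
  case (seq U)
  have [measurable]: "U i \<in> borel_measurable M" for i by (rule measurable_from_subalg[OF G seq(1)])
  have *: "(\<integral>\<^sup>+\<omega>. t \<omega> * (SUP i. U i) \<omega> \<partial>M) = (SUP i. \<integral>\<^sup>+\<omega>. t \<omega> * U i \<omega> \<partial>M)"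
    if [measurable]: "t \<in> borel_measurable M" for t
  proof -
    have "(\<integral>\<^sup>+\<omega>. t \<omega> * (SUP i. U i) \<omega> \<partial>M) = (\<integral>\<^sup>+\<omega>. (SUP i. t \<omega> * U i \<omega>) \<partial>M)"
      by (simp add: SUP_mult_left_ennreal image_comp)
    also have "\<dots> = (SUP i. \<integral>\<^sup>+\<omega>. t \<omega> * U i \<omega> \<partial>M)"
      using seq by (intro nn_integral_monotone_convergence_SUP) (auto simp: incseq_def le_fun_def mult_left_mono)
    finally show ?thesis .
  qed
  show ?case unfolding *[OF assms(2)] *[OF assms(3)] by (rule SUP_mono') (use seq in auto)
qed

lemma integral_mult_mono_subalgebra:
  fixes u v Y :: "'o \<Rightarrow> real"
  assumes G: "subalgebra M G" and int: "integrable M u" "integrable M v"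
    and pos: "\<And>\<omega>. 0 \<le> u \<omega>" "\<And>\<omega>. 0 \<le> v \<omega>"
    and sets: "\<And>A. A \<in> sets G \<Longrightarrow>
      (\<integral>\<^sup>+\<omega>. ennreal (u \<omega>) * indicator A \<omega> \<partial>M) \<le> (\<integral>\<^sup>+\<omega>. ennreal (v \<omega>) * indicator A \<omega> \<partial>M)"
    and Y: "Y \<in> borel_measurable G" "\<And>\<omega>. 0 \<le> Y \<omega>" "\<And>\<omega>. Y \<omega> \<le> c"
  shows "integrable M (\<lambda>\<omega>. Y \<omega> * (u \<omega> - v \<omega>))" "(\<integral>\<omega>. Y \<omega> * (u \<omega> - v \<omega>) \<partial>M) \<le> 0"
proof -
  have [measurable]: "Y \<in> borel_measurable M" by (rule measurable_from_subalg[OF G Y(1)])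
  have [measurable]: "u \<in> borel_measurable M" "v \<in> borel_measurable M" using int by auto
  have bnd: "integrable M (\<lambda>\<omega>. t \<omega> * Y \<omega>)" if "integrable M t" for t
  proof (rule Bochner_Integration.integrable_bound[OF integrable_mult_right[OF that, of c]])
    show "(\<lambda>\<omega>. t \<omega> * Y \<omega>) \<in> borel_measurable M" using that by auto
    have "\<bar>t \<omega>\<bar> * \<bar>Y \<omega>\<bar> \<le> \<bar>c\<bar> * \<bar>t \<omega>\<bar>" for \<omega>
      using mult_left_mono[of "\<bar>Y \<omega>\<bar>" "\<bar>c\<bar>" "\<bar>t \<omega>\<bar>"] Y(2)[of \<omega>] Y(3)[of \<omega>] by (simp add: mult.commute)
    then show "AE \<omega> in M. norm (t \<omega> * Y \<omega>) \<le> norm (c * t \<omega>)" by (simp add: abs_mult)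
  qed
  have "(\<integral>\<^sup>+\<omega>. ennreal (u \<omega>) * ennreal (Y \<omega>) \<partial>M) \<le> (\<integral>\<^sup>+\<omega>. ennreal (v \<omega>) * ennreal (Y \<omega>) \<partial>M)"
    by (rule nn_integral_mult_mono_subalgebra[OF G _ _ sets]) (use Y(1) in auto)
  then have "(\<integral>\<^sup>+\<omega>. ennreal (u \<omega> * Y \<omega>) \<partial>M) \<le> (\<integral>\<^sup>+\<omega>. ennreal (v \<omega> * Y \<omega>) \<partial>M)"
    using pos Y(2) by (simp add: ennreal_mult)
  moreover have "(\<integral>\<^sup>+\<omega>. ennreal (t \<omega> * Y \<omega>) \<partial>M) = ennreal (\<integral>\<omega>. t \<omega> * Y \<omega> \<partial>M)"
    if "integrable M t" "\<And>\<omega>. 0 \<le> t \<omega>" for t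
    using that Y(2) by (intro nn_integral_eq_integral bnd) auto
  ultimately have "ennreal (\<integral>\<omega>. u \<omega> * Y \<omega> \<partial>M) \<le> ennreal (\<integral>\<omega>. v \<omega> * Y \<omega> \<partial>M)"
    using int pos by simp
  moreover have "0 \<le> (\<integral>\<omega>. v \<omega> * Y \<omega> \<partial>M)" using pos Y(2) by (intro integral_nonneg_AE) auto
  ultimately have le: "(\<integral>\<omega>. u \<omega> * Y \<omega> \<partial>M) \<le> (\<integral>\<omega>. v \<omega> * Y \<omega> \<partial>M)"
    by (simp add: ennreal_le_iff)
  have eq: "(\<lambda>\<omega>. Y \<omega> * (u \<omega> - v \<omega>)) = (\<lambda>\<omega>. u \<omega> * Y \<omega> - v \<omega> * Y \<omega>)" by (auto simp: algebra_simps)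
  show "integrable M (\<lambda>\<omega>. Y \<omega> * (u \<omega> - v \<omega>))" unfolding eq by (intro Bochner_Integration.integrable_diff bnd int)
  show "(\<integral>\<omega>. Y \<omega> * (u \<omega> - v \<omega>) \<partial>M) \<le> 0" unfolding eq using le bnd int by simp
qed

section \<open>The weighted inequality up to a finite time\<close>

text \<open>
The scalar data of a martingale \<open>f\<close> in a smooth space: \<open>a n = |f n|\<close>,
\<open>b n = |f n - (f (n+1) - f n)|\<close> and \<open>d n\<close>, the norm of the \<open>n\<close>-th increment.  The remaining argument uses
only these real processes and a weight bounded by \<open>c\<close>.
\<close>

locale weighted_profile = prob_space M for M :: "'o measure" +
  fixes F :: "nat \<Rightarrow> 'o measure" and a b d :: "nat \<Rightarrow> 'o \<Rightarrow> real" and w :: "'o \<Rightarrow> real" and p C c :: real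
  assumes p: "1 < p" "p \<le> 2" and C: "1 \<le> C"
    and sub: "\<And>n. subalgebra M (F n)" and mono: "\<And>n. sets (F n) \<subseteq> sets (F (Suc n))"
    and int: "\<And>n. integrable M (a n)" "\<And>n. integrable M (b n)" "\<And>n. integrable M (d n)"
    and meas: "\<And>n. a n \<in> borel_measurable (F n)" "\<And>n. b n \<in> borel_measurable (F (Suc n))"
      "\<And>n. d n \<in> borel_measurable (F n)"
    and nonneg: "\<And>n \<omega>. 0 \<le> a n \<omega>" "\<And>n \<omega>. 0 \<le> b n \<omega>" "\<And>n \<omega>. 0 \<le> d n \<omega>"
    and a0: "\<And>\<omega>. a 0 \<omega> = d 0 \<omega>" and a_Suc: "\<And>n \<omega>. a (Suc n) \<omega> \<le> a n \<omega> + d (Suc n) \<omega>"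
    and ab: "\<And>n \<omega>. \<bar>a n \<omega> - b n \<omega>\<bar> \<le> d (Suc n) \<omega>"
    and step: "\<And>n \<omega>. a (Suc n) \<omega> powr p \<le> a n \<omega> powr p
      + p * a n \<omega> powr (p - 1) * (a n \<omega> - b n \<omega>) + 2 * C powr p * d (Suc n) \<omega> powr p"
    and drift: "\<And>n A. A \<in> sets (F n) \<Longrightarrow>
      (\<integral>\<^sup>+\<omega>. ennreal (a n \<omega>) * indicator A \<omega> \<partial>M) \<le> (\<integral>\<^sup>+\<omega>. ennreal (b n \<omega>) * indicator A \<omega> \<partial>M)"
    and w: "w \<in> borel_measurable M" "\<And>\<omega>. 0 \<le> w \<omega>" "\<And>\<omega>. w \<omega> \<le> c"
begin

text \<open>
A version of the conditional expectation of the weight that satisfies the bounds \<open>0\<close> and \<open>c\<close>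
everywhere, which keeps all products below integrable.
\<close>

definition v :: "nat \<Rightarrow> 'o \<Rightarrow> real" where
  "v n \<omega> = max 0 (min c (real_cond_exp M (F n) w \<omega>))"

definition S :: "nat \<Rightarrow> 'o \<Rightarrow> real" where "S n \<omega> = partial_square p (\<lambda>k. d k \<omega>) n"
definition m :: "nat \<Rightarrow> 'o \<Rightarrow> real" where "m n \<omega> = run_max (\<lambda>k. a k \<omega>) n"
definition W :: "nat \<Rightarrow> 'o \<Rightarrow> real" where "W n \<omega> = run_max (\<lambda>k. v k \<omega>) n"

lemma c_nonneg: "0 \<le> c"
  using w(2,3)[of undefined] by linarith

lemma F_mono: "i \<le> j \<Longrightarrow> f \<in> borel_measurable (F i) \<Longrightarrow> f \<in> borel_measurable (F j)" for f :: "'o \<Rightarrow> real"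
proof (erule measurable_from_subalg[rotated])
  assume "i \<le> j"
  then have "sets (F i) \<subseteq> sets (F j)" by (rule lift_Suc_mono_le[of "\<lambda>n. sets (F n)", OF mono])
  then show "subalgebra (F j) (F i)" using sub[of i] sub[of j] by (auto simp: subalgebra_def)
qed

lemma F_M: "f \<in> borel_measurable (F i) \<Longrightarrow> f \<in> borel_measurable M" for f :: "'o \<Rightarrow> real"
  by (rule measurable_from_subalg[OF sub])

lemma sigma_finite: "sigma_finite_subalgebra M (F n)"
proof -
  interpret finite_measure_subalgebra M "F n" by standard (rule sub)
  show ?thesis by standard
qed

lemma v_meas: "v n \<in> borel_measurable (F n)"
  unfolding v_def by measurable

lemma v_bounds: "0 \<le> v n \<omega>" "v n \<omega> \<le> c"
  using c_nonneg by (auto simp: v_def)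

lemma W_bounds: "v n \<omega> \<le> W n \<omega>" "0 \<le> W n \<omega>" "W n \<omega> \<le> c"
proof -
  show *: "v n \<omega> \<le> W n \<omega>" unfolding W_def by (rule run_max_ge) simp
  then show "0 \<le> W n \<omega>" using v_bounds(1)[of n \<omega>] by linarith
  show "W n \<omega> \<le> c" unfolding W_def by (rule run_max_le) (rule v_bounds)
qed

lemma run_max_meas:
  fixes u :: "nat \<Rightarrow> 'o \<Rightarrow> real"
  assumes "\<And>n. u n \<in> borel_measurable (F n)"
  shows "(\<lambda>\<omega>. run_max (\<lambda>k. u k \<omega>) n) \<in> borel_measurable (F n)"
proof (induction n)
  case (Suc n)
  have "(\<lambda>\<omega>. run_max (\<lambda>k. u k \<omega>) n) \<in> borel_measurable (F (Suc n))"
    by (rule F_mono[OF _ Suc]) simp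
  from borel_measurable_max[OF assms[of "Suc n"] this] show ?case by simp
qed (simp add: assms)

lemma W_meas: "W n \<in> borel_measurable (F n)"
  using run_max_meas[OF v_meas] by (simp add: W_def[abs_def])

lemma m_meas: "m n \<in> borel_measurable (F n)"
  using run_max_meas[OF meas(1)] by (simp add: m_def[abs_def])

lemma S_meas: "S n \<in> borel_measurable (F n)"
proof -
  have "(\<lambda>\<omega>. (\<Sum>j\<le>n. d j \<omega> powr p) powr (1 / p)) \<in> borel_measurable (F n)"
    by (intro powr_real_measurable borel_measurable_sum F_mono[OF _ meas(3)]) auto
  then show ?thesis by (simp add: S_def[abs_def] partial_square_def)
qed

lemma S_nonneg: "0 \<le> S n \<omega>"
  by (simp add: S_def partial_square_nonneg)

lemma S_integrable: "integrable M (S n)"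
proof (rule Bochner_Integration.integrable_bound)
  show "integrable M (\<lambda>\<omega>. \<Sum>j\<le>n. d j \<omega>)" using int(3) by auto
  show "S n \<in> borel_measurable M" by (rule F_M[OF S_meas])
  have "S n \<omega> \<le> (\<Sum>j\<le>n. d j \<omega>)" for \<omega>
  proof (induction n)
    case 0
    then show ?case using p nonneg(3)[of 0 \<omega>] by (simp add: S_def partial_square_def powr_powr)
  next
    case (Suc n)
    have "S (Suc n) \<omega> \<le> S n \<omega> + d (Suc n) \<omega>"
      using p nonneg(3)[of "Suc n" \<omega>]
      by (intro powr_sum_root_bounds(3)[of p] S_nonneg) (auto simp: S_def partial_square_Suc)
    with Suc show ?case by simp
  qed
  then show "AE \<omega> in M. norm (S n \<omega>) \<le> norm (\<Sum>j\<le>n. d j \<omega>)"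
    using S_nonneg nonneg(3) by (auto simp: sum_nonneg)
qed

lemma m_integrable: "integrable M (m n)"
proof -
  have "integrable M (\<lambda>\<omega>. run_max (\<lambda>k. a k \<omega>) n)"
    by (induction n) (use int(1) in auto)
  then show ?thesis by (simp add: m_def[abs_def])
qed

lemma m_nonneg: "0 \<le> m n \<omega>"
  using run_max_ge[of n n "\<lambda>k. a k \<omega>"] nonneg(1)[of n \<omega>] by (simp add: m_def)

lemma integrable_times_bounded:
  fixes Y g :: "'o \<Rightarrow> real"
  assumes Y: "integrable M Y" and g: "g \<in> borel_measurable M" "\<And>\<omega>. \<bar>g \<omega>\<bar> \<le> c'"
  shows "integrable M (\<lambda>\<omega>. Y \<omega> * g \<omega>)"
proof (rule Bochner_Integration.integrable_bound[OF integrable_mult_right[OF Y, of c']])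
  show "(\<lambda>\<omega>. Y \<omega> * g \<omega>) \<in> borel_measurable M" using Y g(1) by auto
  have "\<bar>Y \<omega>\<bar> * \<bar>g \<omega>\<bar> \<le> \<bar>c'\<bar> * \<bar>Y \<omega>\<bar>" for \<omega>
    using mult_left_mono[of "\<bar>g \<omega>\<bar>" "\<bar>c'\<bar>" "\<bar>Y \<omega>\<bar>"] g(2)[of \<omega>] by (simp add: mult.commute)
  then show "AE \<omega> in M. norm (Y \<omega> * g \<omega>) \<le> norm (c' * Y \<omega>)" by (simp add: abs_mult)
qed

lemma integrable_times_w: "integrable M Y \<Longrightarrow> integrable M (\<lambda>\<omega>. Y \<omega> * w \<omega>)"
  by (rule integrable_times_bounded[where c' = c]) (use w in auto)

lemma integrable_times_v: "integrable M Y \<Longrightarrow> integrable M (\<lambda>\<omega>. Y \<omega> * v n \<omega>)"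
  by (rule integrable_times_bounded[where c' = c]) (use v_bounds F_M[OF v_meas] in auto)

lemma integrable_times_W: "integrable M Y \<Longrightarrow> integrable M (\<lambda>\<omega>. Y \<omega> * W n \<omega>)"
  by (rule integrable_times_bounded[where c' = c]) (use W_bounds F_M[OF W_meas] in auto)

lemma w_integrable: "integrable M w"
  using integrable_times_w[of "\<lambda>_. 1"] by simp

lemma v_eq_real_cond_exp: "AE \<omega> in M. real_cond_exp M (F n) w \<omega> = v n \<omega>"
proof -
  interpret sigma_finite_subalgebra M "F n" by (rule sigma_finite)
  have "AE \<omega> in M. 0 \<le> real_cond_exp M (F n) w \<omega>"
    by (rule real_cond_exp_pos) (use w in auto)
  moreover have "AE \<omega> in M. real_cond_exp M (F n) w \<omega> \<le> c"
    by (rule real_cond_exp_le_c[OF w_integrable]) (use w in auto)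
  ultimately show ?thesis by eventually_elim (auto simp: v_def)
qed

lemma integral_times_w:
  assumes "integrable M Y" "Y \<in> borel_measurable (F n)"
  shows "(\<integral>\<omega>. Y \<omega> * w \<omega> \<partial>M) = (\<integral>\<omega>. Y \<omega> * v n \<omega> \<partial>M)"
proof -
  interpret sigma_finite_subalgebra M "F n" by (rule sigma_finite)
  have "(\<integral>\<omega>. Y \<omega> * w \<omega> \<partial>M) = (\<integral>\<omega>. Y \<omega> * real_cond_exp M (F n) w \<omega> \<partial>M)"
    by (rule real_cond_exp_intg(2)[symmetric]) (use assms integrable_times_w w in auto)
  also have "\<dots> = (\<integral>\<omega>. Y \<omega> * v n \<omega> \<partial>M)"
  proof (rule integral_cong_AE)
    show "AE \<omega> in M. Y \<omega> * real_cond_exp M (F n) w \<omega> = Y \<omega> * v n \<omega>"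
      using v_eq_real_cond_exp[of n] by eventually_elim simp
  qed (use F_M[OF v_meas] assms in auto)
  finally show ?thesis .
qed

lemma integral_weight_increment:
  assumes "integrable M Y" "Y \<in> borel_measurable (F n)"
  shows "(\<integral>\<omega>. Y \<omega> * (v (Suc n) \<omega> - v n \<omega>) \<partial>M) = 0"
proof -
  have "(\<integral>\<omega>. Y \<omega> * v (Suc n) \<omega> \<partial>M) = (\<integral>\<omega>. Y \<omega> * v n \<omega> \<partial>M)"
    using integral_times_w[OF assms] integral_times_w[OF assms(1) F_mono[OF _ assms(2)], of "Suc n"] by simp
  then show ?thesis
    using integrable_times_v[OF assms(1)] by (simp add: right_diff_distrib)
qed

lemma weight_increment_integrable: "integrable M (\<lambda>\<omega>. d (Suc k) \<omega> * \<bar>v (Suc k) \<omega> - v k \<omega>\<bar>)"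
proof (rule integrable_times_bounded[OF int(3), where c' = c])
  show "(\<lambda>\<omega>. \<bar>v (Suc k) \<omega> - v k \<omega>\<bar>) \<in> borel_measurable M"
    using F_M[OF v_meas] by measurable
  show "\<bar>\<bar>v (Suc k) \<omega> - v k \<omega>\<bar>\<bar> \<le> c" for \<omega>
    using v_bounds[of k \<omega>] v_bounds[of "Suc k" \<omega>] by simp
qed

text \<open>
The linear terms in \<open>pathwise_weight_bound\<close> have predictable integrable coefficients \<open>S\<^sub>k v\<^sub>k / W\<^sub>k\<close> and so
integrate to zero against the increments of the weight martingale.
\<close>

lemma weight_square_function_bound:
  "(\<integral>\<omega>. (\<Sum>k<N. d (Suc k) \<omega> * \<bar>v (Suc k) \<omega> - v k \<omega>\<bar>) \<partial>M) \<le> 5 / 2 * (\<integral>\<omega>. S N \<omega> * W N \<omega> \<partial>M)"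
proof -
  let ?Y = "\<lambda>k \<omega>. S k \<omega> * (v k \<omega> / W k \<omega>)"
  have ratio: "\<bar>v k \<omega> / W k \<omega>\<bar> \<le> 1" for k \<omega>
    using v_bounds(1)[of k \<omega>] W_bounds[of k \<omega>] by (auto simp: divide_le_eq_1)
  have Ym: "?Y k \<in> borel_measurable (F k)" for k
    using S_meas v_meas W_meas by measurable
  have Y: "integrable M (?Y k)" for k
    by (rule integrable_times_bounded[OF S_integrable, where c' = 1])
      (use ratio F_M[OF v_meas] F_M[OF W_meas] in auto)
  have Yv: "integrable M (\<lambda>\<omega>. ?Y k \<omega> * (v (Suc k) \<omega> - v k \<omega>))" for k
    using integrable_times_v[OF Y] by (simp add: right_diff_distrib)
  have "(\<integral>\<omega>. (\<Sum>k<N. d (Suc k) \<omega> * \<bar>v (Suc k) \<omega> - v k \<omega>\<bar>) \<partial>M)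
    \<le> (\<integral>\<omega>. 5 / 2 * (S N \<omega> * W N \<omega>) - (\<Sum>k<N. ?Y k \<omega> * (v (Suc k) \<omega> - v k \<omega>)) \<partial>M)"
  proof (rule integral_mono)
    show "integrable M (\<lambda>\<omega>. \<Sum>k<N. d (Suc k) \<omega> * \<bar>v (Suc k) \<omega> - v k \<omega>\<bar>)"
      by (intro Bochner_Integration.integrable_sum weight_increment_integrable)
    show "integrable M (\<lambda>\<omega>. 5 / 2 * (S N \<omega> * W N \<omega>) - (\<Sum>k<N. ?Y k \<omega> * (v (Suc k) \<omega> - v k \<omega>)))"
      by (intro Bochner_Integration.integrable_diff Bochner_Integration.integrable_sum integrable_mult_right
          integrable_times_W S_integrable Yv)
    show "(\<Sum>k<N. d (Suc k) \<omega> * \<bar>v (Suc k) \<omega> - v k \<omega>\<bar>)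
        \<le> 5 / 2 * (S N \<omega> * W N \<omega>) - (\<Sum>k<N. ?Y k \<omega> * (v (Suc k) \<omega> - v k \<omega>))" for \<omega>
      using pathwise_weight_bound[OF p, of "\<lambda>k. d k \<omega>" "\<lambda>k. v k \<omega>" N] nonneg(3) v_bounds(1)
      by (simp add: S_def W_def)
  qed
  also have "\<dots> = 5 / 2 * (\<integral>\<omega>. S N \<omega> * W N \<omega> \<partial>M)"
    using integral_weight_increment[OF Y Ym] Yv integrable_times_W[OF S_integrable]
    by simp
  finally show ?thesis .
qed

text \<open>
The pathwise maximal inequality, multiplied by the weight and integrated.  In the stochastic integral the
weight may be replaced by \<open>v\<^sub>k\<^sub>+\<^sub>1\<close>, as the \<open>k\<close>-th term is known at time \<open>k+1\<close>.  Its part with \<open>v\<^sub>k\<close> has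
nonpositive expectation by the drift condition, and the part with \<open>v\<^sub>k\<^sub>+\<^sub>1 - v\<^sub>k\<close> is the quantity of
\<open>weight_square_function_bound\<close>.
\<close>

lemma weighted_maximal_bound:
  "(p - 1) * (\<integral>\<omega>. m N \<omega> * w \<omega> \<partial>M) \<le> (12 * p * C + 5 / 2 * p) * (\<integral>\<omega>. S N \<omega> * W N \<omega> \<partial>M)"
proof -
  define B where "B = (\<lambda>k \<omega>. max (m k \<omega>) (C * S k \<omega>))"
  define H where "H = (\<lambda>k \<omega>. p * (a k \<omega> powr (p - 1) / B k \<omega> powr (p - 1)))"
  have am: "a k \<omega> \<le> m k \<omega>" for k \<omega> using run_max_ge[of k k "\<lambda>k. a k \<omega>"] by (simp add: m_def)
  have H: "0 \<le> H k \<omega>" "H k \<omega> \<le> p" for k \<omega>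
  proof -
    have "a k \<omega> powr (p - 1) \<le> B k \<omega> powr (p - 1)"
      using p nonneg(1)[of k \<omega>] am[of k \<omega>] by (intro powr_mono2) (auto simp: B_def)
    then have "a k \<omega> powr (p - 1) / B k \<omega> powr (p - 1) \<le> 1" by (simp add: divide_le_eq_1)
    from mult_left_mono[OF this, of p] show "H k \<omega> \<le> p" using p by (simp add: H_def)
    show "0 \<le> H k \<omega>" using p by (simp add: H_def)
  qed
  have Hm: "H k \<in> borel_measurable (F k)" for k
    unfolding H_def B_def using meas(1) m_meas S_meas by measurable
  let ?T = "\<lambda>k \<omega>. H k \<omega> * (a k \<omega> - b k \<omega>)"
  have Tm: "?T k \<in> borel_measurable (F (Suc k))" for k
    using F_mono[OF _ Hm, of k "Suc k"] F_mono[OF _ meas(1), of k "Suc k"] meas(2)[of k] by auto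
  have Tb: "\<bar>?T k \<omega>\<bar> \<le> p * d (Suc k) \<omega>" for k \<omega>
    unfolding abs_mult using H[of k \<omega>] ab[of k \<omega>] p by (intro mult_mono) auto
  have T: "integrable M (?T k)" for k
  proof (rule Bochner_Integration.integrable_bound[OF integrable_mult_right[OF int(3)[of "Suc k"], of p]])
    show "?T k \<in> borel_measurable M" by (rule F_M[OF Tm])
    show "AE \<omega> in M. norm (?T k \<omega>) \<le> norm (p * d (Suc k) \<omega>)"
      using Tb nonneg(3) p by (simp add: abs_mult)
  qed
  have Tw: "(\<integral>\<omega>. ?T k \<omega> * w \<omega> \<partial>M) \<le> p * (\<integral>\<omega>. d (Suc k) \<omega> * \<bar>v (Suc k) \<omega> - v k \<omega>\<bar> \<partial>M)" for k
  proof -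
    have 1: "(\<integral>\<omega>. ?T k \<omega> * v k \<omega> \<partial>M) \<le> 0"
    proof -
      have "(\<integral>\<omega>. (H k \<omega> * v k \<omega>) * (a k \<omega> - b k \<omega>) \<partial>M) \<le> 0"
      proof (rule integral_mult_mono_subalgebra(2)[OF sub int(1) int(2) nonneg(1) nonneg(2) drift])
        show "(\<lambda>\<omega>. H k \<omega> * v k \<omega>) \<in> borel_measurable (F k)" using Hm v_meas by measurable
        show "0 \<le> H k \<omega> * v k \<omega>" for \<omega> using H v_bounds by simp
        show "H k \<omega> * v k \<omega> \<le> p * c" for \<omega> using H v_bounds p by (intro mult_mono) auto
      qed
      then show ?thesis by (simp add: mult_ac)
    qed
    have "(\<integral>\<omega>. ?T k \<omega> * w \<omega> \<partial>M) = (\<integral>\<omega>. ?T k \<omega> * v (Suc k) \<omega> \<partial>M)"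
      by (rule integral_times_w[OF T Tm])
    also have "\<dots> \<le> (\<integral>\<omega>. ?T k \<omega> * v (Suc k) \<omega> \<partial>M) - (\<integral>\<omega>. ?T k \<omega> * v k \<omega> \<partial>M)" using 1 by simp
    also have "\<dots> = (\<integral>\<omega>. ?T k \<omega> * v (Suc k) \<omega> - ?T k \<omega> * v k \<omega> \<partial>M)"
      by (rule Bochner_Integration.integral_diff[symmetric]) (rule integrable_times_v[OF T])+
    also have "\<dots> \<le> (\<integral>\<omega>. p * (d (Suc k) \<omega> * \<bar>v (Suc k) \<omega> - v k \<omega>\<bar>) \<partial>M)"
    proof (rule integral_mono)
      show "integrable M (\<lambda>\<omega>. ?T k \<omega> * v (Suc k) \<omega> - ?T k \<omega> * v k \<omega>)"
        by (intro Bochner_Integration.integrable_diff integrable_times_v T)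
      show "integrable M (\<lambda>\<omega>. p * (d (Suc k) \<omega> * \<bar>v (Suc k) \<omega> - v k \<omega>\<bar>))"
        by (intro integrable_mult_right weight_increment_integrable)
      fix \<omega>
      have "?T k \<omega> * v (Suc k) \<omega> - ?T k \<omega> * v k \<omega> = ?T k \<omega> * (v (Suc k) \<omega> - v k \<omega>)"
        by (rule right_diff_distrib[symmetric])
      also have "\<dots> \<le> \<bar>?T k \<omega>\<bar> * \<bar>v (Suc k) \<omega> - v k \<omega>\<bar>" 
        unfolding abs_mult[symmetric] by (rule abs_ge_self)
      also have "\<dots> \<le> p * d (Suc k) \<omega> * \<bar>v (Suc k) \<omega> - v k \<omega>\<bar>"
        by (intro mult_right_mono Tb) simp
      finally show "?T k \<omega> * v (Suc k) \<omega> - ?T k \<omega> * v k \<omega> \<le> p * (d (Suc k) \<omega> * \<bar>v (Suc k) \<omega> - v k \<omega>\<bar>)"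
        by (simp only: mult.assoc)
    qed
    finally show ?thesis by simp
  qed
  have "(p - 1) * (\<integral>\<omega>. m N \<omega> * w \<omega> \<partial>M) = (\<integral>\<omega>. (p - 1) * (m N \<omega> * w \<omega>) \<partial>M)" by simp
  also have "\<dots> \<le> (\<integral>\<omega>. 12 * p * C * (S N \<omega> * w \<omega>) + (\<Sum>k<N. ?T k \<omega> * w \<omega>) \<partial>M)"
  proof (rule integral_mono)
    show "integrable M (\<lambda>\<omega>. (p - 1) * (m N \<omega> * w \<omega>))"
      by (intro integrable_mult_right integrable_times_w m_integrable)
    show "integrable M (\<lambda>\<omega>. 12 * p * C * (S N \<omega> * w \<omega>) + (\<Sum>k<N. ?T k \<omega> * w \<omega>))"
      by (intro Bochner_Integration.integrable_add Bochner_Integration.integrable_sum integrable_mult_right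
          integrable_times_w S_integrable T)
    fix \<omega>
    have "(p - 1) * m N \<omega> \<le> 12 * p * C * S N \<omega> + (\<Sum>k<N. ?T k \<omega>)"
      using pathwise_maximal_bound[OF p C, of "\<lambda>k. a k \<omega>" "\<lambda>k. d k \<omega>" "\<lambda>k. b k \<omega>" N]
        nonneg a0 a_Suc ab step
      by (simp add: m_def S_def H_def B_def)
    then have "(p - 1) * m N \<omega> * w \<omega> \<le> (12 * p * C * S N \<omega> + (\<Sum>k<N. ?T k \<omega>)) * w \<omega>"
      by (intro mult_right_mono w)
    then show "(p - 1) * (m N \<omega> * w \<omega>) \<le> 12 * p * C * (S N \<omega> * w \<omega>) + (\<Sum>k<N. ?T k \<omega> * w \<omega>)"
      by (simp only: mult.assoc distrib_right sum_distrib_right)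
  qed
  also have "\<dots> = 12 * p * C * (\<integral>\<omega>. S N \<omega> * w \<omega> \<partial>M) + (\<Sum>k<N. \<integral>\<omega>. ?T k \<omega> * w \<omega> \<partial>M)"
    using integrable_times_w[OF S_integrable] integrable_times_w[OF T] by simp
  also have "\<dots> \<le> 12 * p * C * (\<integral>\<omega>. S N \<omega> * W N \<omega> \<partial>M) + p * (5 / 2 * (\<integral>\<omega>. S N \<omega> * W N \<omega> \<partial>M))"
  proof (rule add_mono)
    have "(\<integral>\<omega>. S N \<omega> * w \<omega> \<partial>M) = (\<integral>\<omega>. S N \<omega> * v N \<omega> \<partial>M)"
      by (rule integral_times_w[OF S_integrable S_meas])
    also have "\<dots> \<le> (\<integral>\<omega>. S N \<omega> * W N \<omega> \<partial>M)"
      by (intro integral_mono integrable_times_v integrable_times_W S_integrable mult_left_mono W_bounds S_nonneg)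
    finally show "12 * p * C * (\<integral>\<omega>. S N \<omega> * w \<omega> \<partial>M) \<le> 12 * p * C * (\<integral>\<omega>. S N \<omega> * W N \<omega> \<partial>M)"
      using p C by (intro mult_left_mono) auto
    have "(\<Sum>k<N. \<integral>\<omega>. ?T k \<omega> * w \<omega> \<partial>M) \<le> (\<Sum>k<N. p * (\<integral>\<omega>. d (Suc k) \<omega> * \<bar>v (Suc k) \<omega> - v k \<omega>\<bar> \<partial>M))"
      by (intro sum_mono Tw)
    also have "\<dots> = p * (\<integral>\<omega>. (\<Sum>k<N. d (Suc k) \<omega> * \<bar>v (Suc k) \<omega> - v k \<omega>\<bar>) \<partial>M)"
      using weight_increment_integrable by (simp add: sum_distrib_left)
    also have "\<dots> \<le> p * (5 / 2 * (\<integral>\<omega>. S N \<omega> * W N \<omega> \<partial>M))"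
      using p by (intro mult_left_mono weight_square_function_bound) auto
    finally show "(\<Sum>k<N. \<integral>\<omega>. ?T k \<omega> * w \<omega> \<partial>M) \<le> p * (5 / 2 * (\<integral>\<omega>. S N \<omega> * W N \<omega> \<partial>M))" .
  qed
  also have "\<dots> = (12 * p * C + 5 / 2 * p) * (\<integral>\<omega>. S N \<omega> * W N \<omega> \<partial>M)"
    by (simp only: distrib_right mult.assoc mult.left_commute[of p "5 / 2"])
  finally show ?thesis .
qed

lemma SW_integrable: "integrable M (\<lambda>\<omega>. S N \<omega> * W N \<omega>)"
  by (intro integrable_times_W S_integrable)

text \<open>
The real conditional expectation is the difference of two nonnegative ones, of which the first is the
one in the definition of the maximal weight; clipping at \<open>c\<close> only makes it smaller.
\<close>

lemma W_le_maximal_weight: "ennreal (W N \<omega>) \<le> maximal_weight M F w \<omega>"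
proof -
  have "ennreal (v n \<omega>) \<le> maximal_weight M F w \<omega>" for n
  proof -
    have "ennreal (v n \<omega>) \<le> ennreal (enn2real (nn_cond_exp M (F n) (\<lambda>\<omega>. ennreal (w \<omega>)) \<omega>))"
      by (auto simp: v_def real_cond_exp_def intro!: ennreal_leI min.coboundedI2)
    also have "\<dots> \<le> nn_cond_exp M (F n) (\<lambda>\<omega>. ennreal (w \<omega>)) \<omega>"
      by (cases "nn_cond_exp M (F n) (\<lambda>\<omega>. ennreal (w \<omega>)) \<omega>") auto
    also have "\<dots> \<le> maximal_weight M F w \<omega>"
      unfolding maximal_weight_def by (rule SUP_upper) simp
    finally show ?thesis .
  qed
  then have "ennreal (run_max (\<lambda>k. v k \<omega>) N) \<le> maximal_weight M F w \<omega>"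
    by (induction N) (auto simp: max_def)
  then show ?thesis by (simp add: W_def)
qed

lemma nn_weighted_maximal_bound:
  "ennreal (p - 1) * (\<integral>\<^sup>+\<omega>. ennreal (run_max (\<lambda>k. a k \<omega>) N * w \<omega>) \<partial>M)
    \<le> ennreal (12 * p * C + 5 / 2 * p)
      * (\<integral>\<^sup>+\<omega>. ennreal (partial_square p (\<lambda>k. d k \<omega>) N) * maximal_weight M F w \<omega> \<partial>M)"
proof -
  have "(\<integral>\<^sup>+\<omega>. ennreal (m N \<omega> * w \<omega>) \<partial>M) = ennreal (\<integral>\<omega>. m N \<omega> * w \<omega> \<partial>M)"
    by (intro nn_integral_eq_integral integrable_times_w m_integrable AE_I2 mult_nonneg_nonneg m_nonneg w)
  then have "ennreal (p - 1) * (\<integral>\<^sup>+\<omega>. ennreal (m N \<omega> * w \<omega>) \<partial>M) = ennreal ((p - 1) * (\<integral>\<omega>. m N \<omega> * w \<omega> \<partial>M))"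
    using p by (subst ennreal_mult') auto
  also have "\<dots> \<le> ennreal ((12 * p * C + 5 / 2 * p) * (\<integral>\<omega>. S N \<omega> * W N \<omega> \<partial>M))"
    by (rule ennreal_leI[OF weighted_maximal_bound])
  also have "\<dots> = ennreal (12 * p * C + 5 / 2 * p) * ennreal (\<integral>\<omega>. S N \<omega> * W N \<omega> \<partial>M)"
    using p C by (intro ennreal_mult') auto
  also have "ennreal (\<integral>\<omega>. S N \<omega> * W N \<omega> \<partial>M) = (\<integral>\<^sup>+\<omega>. ennreal (S N \<omega> * W N \<omega>) \<partial>M)"
    by (intro nn_integral_eq_integral[symmetric] SW_integrable AE_I2 mult_nonneg_nonneg S_nonneg W_bounds)
  also have "\<dots> \<le> (\<integral>\<^sup>+\<omega>. ennreal (S N \<omega>) * maximal_weight M F w \<omega> \<partial>M)"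
    by (intro nn_integral_mono) (simp add: ennreal_mult' S_nonneg mult_left_mono W_le_maximal_weight)
  finally show ?thesis by (simp add: m_def S_def mult_left_mono)
qed

end

section \<open>From finite times to the full inequality\<close>

lemma ennpowr_mono: "0 \<le> r \<Longrightarrow> x \<le> y \<Longrightarrow> ennpowr x r \<le> ennpowr y r"
  by (auto simp: ennpowr_def top_unique less_top intro!: ennreal_leI powr_mono2 enn2real_mono)

lemma partial_square_le_square_fun:
  assumes p: "1 < p"
  shows "ennreal (partial_square p (\<lambda>k. case k of 0 \<Rightarrow> norm (f 0 \<omega>) | Suc k \<Rightarrow> norm (f (Suc k) \<omega> - f k \<omega>)) N)
    \<le> square_fun p f \<omega>"
proof -
  let ?d = "\<lambda>k. case k of 0 \<Rightarrow> norm (f 0 \<omega>) | Suc k \<Rightarrow> norm (f (Suc k) \<omega> - f k \<omega>)"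
  have "ennreal (partial_square p ?d N) = ennpowr (ennreal (\<Sum>j\<le>N. ?d j powr p)) (1 / p)"
    by (simp add: partial_square_def ennpowr_def sum_nonneg)
  also have "(\<Sum>j\<le>N. ?d j powr p) = norm (f 0 \<omega>) powr p + (\<Sum>j<N. norm (f (Suc j) \<omega> - f j \<omega>) powr p)"
    by (simp add: sum.atMost_shift)
  also have "ennreal \<dots> = ennreal (norm (f 0 \<omega>) powr p) + (\<Sum>j<N. ennreal (norm (f (Suc j) \<omega> - f j \<omega>) powr p))"
    by (simp add: sum_nonneg sum_ennreal)
  also have "ennpowr \<dots> (1 / p) \<le> square_fun p f \<omega>"
    unfolding square_fun_def using p by (intro ennpowr_mono add_left_mono sum_le_suminf) auto
  finally show ?thesis .
qed

text \<open>
A single index serves for both limits, the time horizon and the truncation level of the weight, so that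
one application of monotone convergence removes both.
\<close>

lemma maximal_fun_times_weight_le:
  assumes "0 \<le> w \<omega>"
  shows "maximal_fun f \<omega> * ennreal (w \<omega>)
    \<le> (SUP i. ennreal (run_max (\<lambda>k. norm (f k \<omega>)) i * max 0 (min (real i) (w \<omega>))))"
proof -
  have "ennreal (norm (f n \<omega>)) * ennreal (w \<omega>)
      \<le> (SUP i. ennreal (run_max (\<lambda>k. norm (f k \<omega>)) i * max 0 (min (real i) (w \<omega>))))" for n
  proof -
    obtain i0 where "w \<omega> \<le> real i0" using real_arch_simple by blast
    then obtain i where i: "n \<le> i" "w \<omega> \<le> real i"
      by (metis le_cases of_nat_mono order_trans)
    have "norm (f n \<omega>) * w \<omega> \<le> run_max (\<lambda>k. norm (f k \<omega>)) i * max 0 (min (real i) (w \<omega>))"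
      using i assms run_max_ge[OF i(1), of "\<lambda>k. norm (f k \<omega>)"] by (simp add: mult_right_mono)
    then have "ennreal (norm (f n \<omega>) * w \<omega>) \<le> ennreal (run_max (\<lambda>k. norm (f k \<omega>)) i * max 0 (min (real i) (w \<omega>)))"
      by (rule ennreal_leI)
    then show ?thesis by (intro SUP_upper2[of i]) (auto simp: ennreal_mult')
  qed
  then show ?thesis
    unfolding maximal_fun_def by (simp add: SUP_mult_right_ennreal SUP_le_iff)
qed

lemma martingale_separable_versions:
  fixes f :: "nat \<Rightarrow> 'o \<Rightarrow> 'b::banach"
  assumes "martingale M F f" "\<And>n. subalgebra M (F n)"
  obtains g Q where "\<And>n. g n \<in> borel_measurable (F n)" "\<And>n. countable (Q n)"
    "\<And>n. g n ` space (F n) \<subseteq> closure (Q n)" "\<And>n. AE \<omega> in M. f n \<omega> = g n \<omega>"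
proof -
  have "\<exists>g Q. g \<in> borel_measurable (F n) \<and> countable Q \<and> g ` space (F n) \<subseteq> closure Q \<and> (AE \<omega> in M. f n \<omega> = g \<omega>)" for n
  proof -
    obtain x where "has_bint M (f n) x" and "f n \<in> borel_measurable (F n)"
      using assms(1) unfolding martingale_def bintegrable_def by blast
    from separable_version[OF this assms(2)] show ?thesis by metis
  qed
  then show thesis using that by metis
qed

theorem theorem1p1:
  fixes p p' C :: real
    and M :: "'o measure"
    and F :: "nat \<Rightarrow> 'o measure"
    and f :: "nat \<Rightarrow> 'o \<Rightarrow> 'b::banach"
    and w :: "'o \<Rightarrow> real"
  assumes "1 < p" and "p \<le> 2"
    and "1 / p + 1 / p' = 1"
    and "0 < C"
    and "smooth_space TYPE('b) p C"
    and "prob_space M"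
    and "filtration (space M) F"
    and "\<And>n. subalgebra M (F n)"
    and "martingale M F f"
    and "w \<in> borel_measurable M"
    and "\<And>\<omega>. \<omega> \<in> space M \<Longrightarrow> 0 \<le> w \<omega>"
  shows "(\<integral>\<^sup>+\<omega>. maximal_fun f \<omega> * ennreal (w \<omega>) \<partial>M)
           \<le> ennreal (84 * p' * C) *
             (\<integral>\<^sup>+\<omega>. square_fun p f \<omega> * maximal_weight M F w \<omega> \<partial>M)"
proof (cases "\<exists>y :: 'b. y \<noteq> 0")
  case False
  then have "norm (f n \<omega>) = 0" for n \<omega> by (metis norm_zero)
  then have "maximal_fun f \<omega> = 0" for \<omega>
    by (simp add: maximal_fun_def)
  then show ?thesis by simp
next
  case True
  then have C1: "1 \<le> C" using smooth_const_ge_1[OF assms(5)] assms(1,4) by auto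
  note p = assms(1,2) and M = assms(6) and sub = assms(8)
  interpret prob_space M by fact
  have sets_mono: "sets (F n) \<subseteq> sets (F (Suc n))" for n
    using filtration.sets_F_mono[OF assms(7), of n "Suc n"] by simp
  have subS: "subalgebra (F (Suc n)) (F n)" for n
    using sets_mono[of n] sub[of n] sub[of "Suc n"] by (simp add: subalgebra_def)
  obtain g Q where g: "\<And>n. g n \<in> borel_measurable (F n)" "\<And>n. countable (Q n)"
    "\<And>n. g n ` space (F n) \<subseteq> closure (Q n)" and fg: "\<And>n. AE \<omega> in M. f n \<omega> = g n \<omega>"
    using martingale_separable_versions[OF assms(9) sub] by blast
  have sm: "strongly_measurable (F n) (g n)" "strongly_measurable (F (Suc n)) (g n)" "strongly_measurable M (g n)" for n
    using strongly_measurable_separable[OF g(1,2,3)] strongly_measurable_subalgebra[OF _ subS] strongly_measurable_subalgebra[OF _ sub] by blast+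
  have "\<exists>x. has_bint M (f n) x" for n
    using assms(9) unfolding martingale_def bintegrable_def by blast
  then have g_int: "integrable M (\<lambda>\<omega>. norm (g n \<omega>))" for n
    using has_bint_nn_integral_norm_finite[OF _ fg sm(3)] strongly_measurable_norm_borel[OF sm(3)]
    by (intro integrableI_bounded) auto
  have cond: "\<exists>x. has_bint M (\<lambda>\<omega>. indicator A \<omega> *\<^sub>R f (Suc n) \<omega>) x \<and> has_bint M (\<lambda>\<omega>. indicator A \<omega> *\<^sub>R f n \<omega>) x"
    if "A \<in> sets (F n)" for A n
    using assms(9) that unfolding martingale_def is_cond_exp_def by (meson le_SucI le_refl)
  define a where "a = (\<lambda>n \<omega>. norm (g n \<omega>))"
  define b where "b = (\<lambda>n \<omega>. norm (g n \<omega> - (g (Suc n) \<omega> - g n \<omega>)))"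
  define d where "d = (\<lambda>n \<omega>. case n of 0 \<Rightarrow> norm (g 0 \<omega>) | Suc k \<Rightarrow> norm (g (Suc k) \<omega> - g k \<omega>))"
  have d_Suc: "d (Suc n) = (\<lambda>\<omega>. norm (g (Suc n) \<omega> - g n \<omega>))" for n by (simp add: d_def)
  have a_meas: "a n \<in> borel_measurable (F n)" for n
    unfolding a_def by (intro strongly_measurable_norm_borel sm)
  have b_meas: "b n \<in> borel_measurable (F (Suc n))" for n
    unfolding b_def by (intro strongly_measurable_norm_borel strongly_measurable_diff sm)
  have d_Suc_meas: "d (Suc n) \<in> borel_measurable (F (Suc n))" for n
    unfolding d_Suc by (intro strongly_measurable_norm_borel strongly_measurable_diff sm)
  have d_meas: "d n \<in> borel_measurable (F n)" for n
    using d_Suc_meas a_meas[of 0] by (cases n) (simp_all add: a_def d_def)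
  have a_int: "integrable M (a n)" for n
    using g_int by (simp add: a_def)
  have d_Suc_int: "integrable M (d (Suc n))" for n
  proof (rule Bochner_Integration.integrable_bound)
    show "integrable M (\<lambda>\<omega>. norm (g (Suc n) \<omega>) + norm (g n \<omega>))" using g_int by auto
    show "d (Suc n) \<in> borel_measurable M" by (rule measurable_from_subalg[OF sub d_meas])
  qed (simp add: d_Suc norm_triangle_ineq4)
  have d_int: "integrable M (d n)" for n
    using d_Suc_int a_int[of 0] by (cases n) (simp_all add: a_def d_def)
  have ab: "\<bar>a n \<omega> - b n \<omega>\<bar> \<le> d (Suc n) \<omega>" for n \<omega>
    unfolding a_def b_def d_Suc using norm_triangle_ineq3[of "g n \<omega>" "g n \<omega> - (g (Suc n) \<omega> - g n \<omega>)"] by simp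
  have b_int: "integrable M (b n)" for n
  proof (rule Bochner_Integration.integrable_bound)
    show "integrable M (\<lambda>\<omega>. a n \<omega> + d (Suc n) \<omega>)" using a_int d_int by auto
    show "b n \<in> borel_measurable M" by (rule measurable_from_subalg[OF sub b_meas])
    have "norm (b n \<omega>) \<le> norm (a n \<omega> + d (Suc n) \<omega>)" for \<omega>
    proof -
      have "0 \<le> b n \<omega>" by (simp add: b_def)
      then show ?thesis using ab[of n \<omega>] unfolding real_norm_def by linarith
    qed
    then show "AE \<omega> in M. norm (b n \<omega>) \<le> norm (a n \<omega> + d (Suc n) \<omega>)" by simp
  qed
  define wt where "wt = (\<lambda>(i::nat) \<omega>. max 0 (min (real i) (w \<omega>)))"
  have profile: "weighted_profile M F a b d (wt i) p C (real i)" for i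
  proof (intro weighted_profile.intro[OF M] weighted_profile_axioms.intro p C1 sub sets_mono a_int b_int d_int
      a_meas b_meas d_meas ab)
    show "0 \<le> a n \<omega>" "0 \<le> b n \<omega>" "0 \<le> d n \<omega>" for n \<omega>
      by (auto simp: a_def b_def d_def split: nat.split)
    show "a 0 \<omega> = d 0 \<omega>" for \<omega> by (simp add: a_def d_def)
    show "a (Suc n) \<omega> \<le> a n \<omega> + d (Suc n) \<omega>" for n \<omega>
      using norm_triangle_sub[of "g (Suc n) \<omega>" "g n \<omega>"] by (simp add: a_def d_Suc)
    show "a (Suc n) \<omega> powr p \<le> a n \<omega> powr p + p * a n \<omega> powr (p - 1) * (a n \<omega> - b n \<omega>)
        + 2 * C powr p * d (Suc n) \<omega> powr p" for n \<omega>
      using smooth_space_step[OF assms(5), of "g n \<omega>" "g (Suc n) \<omega> - g n \<omega>"] p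
      by (simp add: a_def b_def d_Suc)
    show "(\<integral>\<^sup>+\<omega>. ennreal (a n \<omega>) * indicator A \<omega> \<partial>M) \<le> (\<integral>\<^sup>+\<omega>. ennreal (b n \<omega>) * indicator A \<omega> \<partial>M)"
      if "A \<in> sets (F n)" for n A
      unfolding a_def b_def
      by (rule conditional_jensen_reflected[OF M sub cond fg fg sm(3) g that])
    show "wt i \<in> borel_measurable M" unfolding wt_def using assms(10) by measurable
    show "0 \<le> wt i \<omega>" "wt i \<omega> \<le> real i" for \<omega> by (auto simp: wt_def)
  qed
  define R where "R = (\<integral>\<^sup>+\<omega>. square_fun p f \<omega> * maximal_weight M F w \<omega> \<partial>M)"
  have fg_all: "AE \<omega> in M. \<forall>n. f n \<omega> = g n \<omega>"
    using fg by (simp add: AE_all_countable)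
  have finite_bound: "(\<integral>\<^sup>+\<omega>. ennreal (run_max (\<lambda>k. a k \<omega>) i * wt i \<omega>) \<partial>M) \<le> ennreal (84 * p' * C) * R" for i
  proof -
    interpret weighted_profile M F a b d "wt i" p C "real i" by (rule profile)
    \<comment> \<open>Truncation decreases the weight and hence its conditional expectations.\<close>
    have wt_le: "AE \<omega> in M. \<forall>n. nn_cond_exp M (F n) (\<lambda>\<omega>. ennreal (wt i \<omega>)) \<omega> \<le> nn_cond_exp M (F n) (\<lambda>\<omega>. ennreal (w \<omega>)) \<omega>"
      unfolding AE_all_countable
    proof
      fix n
      interpret sigma_finite_subalgebra M "F n" by (rule sigma_finite)
      show "AE \<omega> in M. nn_cond_exp M (F n) (\<lambda>\<omega>. ennreal (wt i \<omega>)) \<omega> \<le> nn_cond_exp M (F n) (\<lambda>\<omega>. ennreal (w \<omega>)) \<omega>"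
        using assms(10,11) w(1) by (intro nn_cond_exp_mono AE_I2 ennreal_leI) (auto simp: wt_def)
    qed
    have "(\<integral>\<^sup>+\<omega>. ennreal (partial_square p (\<lambda>k. d k \<omega>) i) * maximal_weight M F (wt i) \<omega> \<partial>M) \<le> R"
      unfolding R_def
    proof (rule nn_integral_mono_AE)
      show "AE \<omega> in M. ennreal (partial_square p (\<lambda>k. d k \<omega>) i) * maximal_weight M F (wt i) \<omega>
          \<le> square_fun p f \<omega> * maximal_weight M F w \<omega>"
        using wt_le fg_all
      proof eventually_elim
        case (elim \<omega>)
        have "ennreal (partial_square p (\<lambda>k. d k \<omega>) i) \<le> square_fun p g \<omega>"
          using partial_square_le_square_fun[OF p(1), of g \<omega> i] by (simp add: d_def)
        also have "square_fun p g \<omega> = square_fun p f \<omega>" using elim(2) by (simp add: square_fun_def)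
        finally show ?case
          using elim(1) by (intro mult_mono) (auto simp: maximal_weight_def intro!: SUP_mono')
      qed
    qed
    then have "ennreal (p - 1) * (\<integral>\<^sup>+\<omega>. ennreal (run_max (\<lambda>k. a k \<omega>) i * wt i \<omega>) \<partial>M)
        \<le> ennreal (12 * p * C + 5 / 2 * p) * R"
      using nn_weighted_maximal_bound[of i] by (meson mult_left_mono order_trans zero_le)
    then have "ennreal (1 / (p - 1)) * (ennreal (p - 1) * (\<integral>\<^sup>+\<omega>. ennreal (run_max (\<lambda>k. a k \<omega>) i * wt i \<omega>) \<partial>M))
        \<le> ennreal (1 / (p - 1)) * (ennreal (12 * p * C + 5 / 2 * p) * R)"
      by (rule mult_left_mono) simp
    moreover have "ennreal (1 / (p - 1)) * ennreal (p - 1) = 1"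
      using p by (simp flip: ennreal_mult')
    moreover have "ennreal (1 / (p - 1)) * ennreal (12 * p * C + 5 / 2 * p)
        = ennreal (1 / (p - 1) * (12 * p * C + 5 / 2 * p))"
      using p by (intro ennreal_mult'[symmetric]) simp
    ultimately have "(\<integral>\<^sup>+\<omega>. ennreal (run_max (\<lambda>k. a k \<omega>) i * wt i \<omega>) \<partial>M)
        \<le> ennreal (1 / (p - 1) * (12 * p * C + 5 / 2 * p)) * R"
      by (simp only: mult.assoc[symmetric] mult_1)
    also have "\<dots> \<le> ennreal (84 * p' * C) * R"
    proof (intro mult_right_mono ennreal_leI)
      have p': "p' = p / (p - 1)"
        using assms(1,3) by (cases "p' = 0") (auto simp: field_simps)
      \<comment> \<open>As \<open>1 \<le> C\<close>, the constant \<open>12 p C + 5 p / 2\<close> is at most \<open>84 p C\<close>, and \<open>p / (p - 1) = p'\<close>.\<close>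
      have "p * 1 \<le> p * C" using C1 p by (intro mult_left_mono) auto
      then have "(12 * p * C + 5 / 2 * p) \<le> 84 * (p * C)" using p C1 by simp
      then have "1 / (p - 1) * (12 * p * C + 5 / 2 * p) \<le> 1 / (p - 1) * (84 * (p * C))"
        using p by (intro mult_left_mono) auto
      then show "1 / (p - 1) * (12 * p * C + 5 / 2 * p) \<le> 84 * p' * C" by (simp add: p')
    qed simp
    finally show ?thesis .
  qed
  have "(\<integral>\<^sup>+\<omega>. maximal_fun f \<omega> * ennreal (w \<omega>) \<partial>M)
      \<le> (\<integral>\<^sup>+\<omega>. (SUP i. ennreal (run_max (\<lambda>k. a k \<omega>) i * wt i \<omega>)) \<partial>M)"
  proof (rule nn_integral_mono_AE)
    show "AE \<omega> in M. maximal_fun f \<omega> * ennreal (w \<omega>) \<le> (SUP i. ennreal (run_max (\<lambda>k. a k \<omega>) i * wt i \<omega>))"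
      using fg_all AE_space
    proof eventually_elim
      case (elim \<omega>)
      then have "maximal_fun f \<omega> = maximal_fun g \<omega>" by (simp add: maximal_fun_def)
      then show ?case
        using maximal_fun_times_weight_le[of w \<omega> g] assms(11) elim(2) by (simp add: a_def wt_def)
    qed
  qed
  also have "\<dots> = (SUP i. \<integral>\<^sup>+\<omega>. ennreal (run_max (\<lambda>k. a k \<omega>) i * wt i \<omega>) \<partial>M)"
  proof (rule nn_integral_monotone_convergence_SUP)
    have "0 \<le> run_max (\<lambda>k. a k \<omega>) i" for i \<omega>
      using run_max_ge[OF order_refl, of "\<lambda>k. a k \<omega>" i] norm_ge_zero[of "g i \<omega>"] unfolding a_def by linarith
    then show "incseq (\<lambda>i \<omega>. ennreal (run_max (\<lambda>k. a k \<omega>) i * wt i \<omega>))"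
      by (auto simp: incseq_def le_fun_def wt_def intro!: ennreal_leI mult_mono run_max_mono)
    fix i
    interpret weighted_profile M F a b d "wt i" p C "real i" by (rule profile)
    show "(\<lambda>\<omega>. ennreal (run_max (\<lambda>k. a k \<omega>) i * wt i \<omega>)) \<in> borel_measurable M"
      using F_M[OF run_max_meas[OF meas(1)], of i] w(1) by measurable
  qed
  also have "\<dots> \<le> ennreal (84 * p' * C) * R"
    by (rule SUP_least) (rule finite_bound)
  finally show ?thesis by (simp add: R_def)
qed

end
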